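(* Let $H\in C^2(\mathbb{R}^4)$, $E\in\mathbb{R}$, let $x_0\in\mathrm{Crit}(\pi_E)$, put $b_0=\pi(x_0)$, and assume $H$ is smooth near $x_0$. Assume the nondegeneracy condition (N): $\partial^2_{p_1p_1}H(x_0)\neq0$, and the transversality condition (T): $d_b\mathcal{E}^{c}(b_0)\neq0$, where $\mathcal{E}^c$ is the local critical value function defined in the context. Then $\Sigma_E^{\mathrm{sec}}$ is a smooth surface near $x_0$, and there are local coordinates $(u,v)$ on $\Sigma_E^{\mathrm{sec}}$ and $(u,s)$ on $\mathbb{R}^2$ in which $$\pi_E\colon(u,v)\longmapsto(u,v^2),$$ i.e. $\pi_E$ has a Whitney fold at $x_0$. The sign of $\partial^2_{p_1p_1}H(x_0)$ fixes the side of $\{\mathcal{E}^c=E\}$ on which the two real preimages lie.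
   Context: Coordinates on $\mathbb{R}^4$ are $(q_1,q_2,p_1,p_2)$. Let $C=\{q_1=0\}$, with coordinates $(q_2,p_1,p_2)$, and $\pi\colon C\to\mathbb{R}^2$, $\pi(0,q_2,p_1,p_2)=b=(q_2,p_2)$. Put $\Sigma_E^{\mathrm{sec}}=\{H=E\}\cap C$, $\pi_E=\pi|_{\Sigma_E^{\mathrm{sec}}}$, and $\mathrm{Crit}(\pi_E)=\{x\in\Sigma_E^{\mathrm{sec}}:\partial_{p_1}H(x)=0\}$. When $x_0\in\mathrm{Crit}(\pi_E)$ and $\partial^2_{p_1p_1}H(x_0)\ne0$, the implicit function theorem gives a unique local branch $p_1=p_1^c(b)$ near $b_0=\pi(x_0)$ passing through $x_0$ with $\partial_{p_1}H(0,q_2,p_1^c(b),p_2)=0$; the local critical value function is $\mathcal{E}^c(b)=H(0,q_2,p_1^c(b),p_2)$. *)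

theory Defs
  imports "HOL-Analysis.Analysis"
begin

section \<open>Differentiability classes\<close>

text \<open>Meant for open \<open>S\<close> in a finite-dimensional space, where continuity of all iterated
  directional derivatives is the usual notion of being of class \<open>C\<^sup>k\<close>.\<close>

primrec Ck_on :: "nat \<Rightarrow> 'a::real_normed_vector set \<Rightarrow> ('a \<Rightarrow> 'b::real_normed_vector) \<Rightarrow> bool" where
  "Ck_on 0 S f \<longleftrightarrow> continuous_on S f"
| "Ck_on (Suc k) S f \<longleftrightarrow>
     (\<forall>x\<in>S. f differentiable (at x)) \<and>
     (\<forall>h. Ck_on k S (\<lambda>x. frechet_derivative f (at x) h))"

definition smooth_on :: "'a::real_normed_vector set \<Rightarrow> ('a \<Rightarrow> 'b::real_normed_vector) \<Rightarrow> bool" where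
  "smooth_on S f \<longleftrightarrow> (\<forall>k. Ck_on k S f)"

text \<open>Smoothness on an arbitrary subset of a Euclidean space: local smooth extensions to the
  ambient space exist.\<close>

definition smooth_map_on :: "'a::euclidean_space set \<Rightarrow> ('a \<Rightarrow> 'b::euclidean_space) \<Rightarrow> bool" where
  "smooth_map_on S f \<longleftrightarrow>
     (\<forall>x\<in>S. \<exists>U g. open U \<and> x \<in> U \<and> smooth_on U g \<and> (\<forall>y\<in>S \<inter> U. f y = g y))"

definition diffeo_onto_image :: "'a::euclidean_space set \<Rightarrow> ('a \<Rightarrow> 'b::euclidean_space) \<Rightarrow> bool" where
  "diffeo_onto_image S f \<longleftrightarrow>
     inj_on f S \<and> smooth_map_on S f \<and> smooth_map_on (f ` S) (inv_into S f)"

section \<open>Surfaces, local coordinates, Whitney folds\<close>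

text \<open>Coordinates \<open>\<phi>\<close> on \<open>S \<inter> U\<close>, centred at \<open>x\<close>. For \<open>S = UNIV\<close> in the plane
  these are ordinary local coordinates on the plane.\<close>

definition local_coordinates ::
    "'a::euclidean_space set \<Rightarrow> 'a \<Rightarrow> 'a set \<Rightarrow> ('a \<Rightarrow> real \<times> real) \<Rightarrow> bool" where
  "local_coordinates S x U \<phi> \<longleftrightarrow>
     open U \<and> x \<in> S \<inter> U \<and> open (\<phi> ` (S \<inter> U)) \<and> diffeo_onto_image (S \<inter> U) \<phi> \<and> \<phi> x = (0, 0)"

text \<open>Centring the coordinates is no restriction, as they may be translated. The same \<open>U\<close>
  serves every point of \<open>S \<inter> U\<close>, so \<open>S \<inter> U\<close> is an embedded two-dimensional submanifold.\<close>

definition smooth_surface_near :: "'a::euclidean_space set \<Rightarrow> 'a \<Rightarrow> bool" where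
  "smooth_surface_near S x \<longleftrightarrow> (\<exists>U \<phi>. local_coordinates S x U \<phi>)"

definition whitney_fold_at ::
    "'a::euclidean_space set \<Rightarrow> ('a \<Rightarrow> real \<times> real) \<Rightarrow> 'a \<Rightarrow> bool" where
  "whitney_fold_at S f x \<longleftrightarrow>
     (\<exists>U \<phi> V \<theta>. local_coordinates S x U \<phi> \<and> local_coordinates UNIV (f x) V \<theta> \<and>
        f ` (S \<inter> U) \<subseteq> V \<and>
        (\<forall>y\<in>S \<inter> U. \<forall>u v. \<phi> y = (u, v) \<longrightarrow> \<theta> (f y) = (u, v\<^sup>2)))"

section \<open>The section of an energy level and its projection\<close>

text \<open>Points of \<open>\<real>\<^sup>4\<close> are tuples \<open>(q\<^sub>1, q\<^sub>2, p\<^sub>1, p\<^sub>2)\<close>.\<close>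

type_synonym phase = "real \<times> real \<times> real \<times> real"

definition plane_C :: "phase set" where
  "plane_C = {(q1, q2, p1, p2). q1 = 0}"

fun proj :: "phase \<Rightarrow> real \<times> real" where
  "proj (q1, q2, p1, p2) = (q2, p2)"

fun p1_coord :: "phase \<Rightarrow> real" where
  "p1_coord (q1, q2, p1, p2) = p1"

fun d_p1 :: "(phase \<Rightarrow> real) \<Rightarrow> phase \<Rightarrow> real" where
  "d_p1 H (q1, q2, p1, p2) = deriv (\<lambda>t. H (q1, q2, t, p2)) p1"

definition sec :: "(phase \<Rightarrow> real) \<Rightarrow> real \<Rightarrow> phase set" where
  "sec H E = {x. H x = E} \<inter> plane_C"

definition Crit :: "(phase \<Rightarrow> real) \<Rightarrow> real \<Rightarrow> phase set" where
  "Crit H E = {x \<in> sec H E. d_p1 H x = 0}"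

definition is_crit_branch :: "(phase \<Rightarrow> real) \<Rightarrow> phase \<Rightarrow> (real \<times> real \<Rightarrow> real) \<Rightarrow> bool" where
  "is_crit_branch H x0 pc \<longleftrightarrow>
     (\<exists>B. open B \<and> proj x0 \<in> B \<and> continuous_on B pc \<and> pc (proj x0) = p1_coord x0 \<and>
        (\<forall>(q2, p2)\<in>B. d_p1 H (0, q2, pc (q2, p2), p2) = 0))"

text \<open>If \<open>x0 \<in> Crit H E\<close>, \<open>H\<close> is \<open>C\<^sup>2\<close> and \<open>d_p1 (d_p1 H) x0 \<noteq> 0\<close>, the implicit
  function theorem provides a branch, and any two branches agree near \<open>proj x0\<close>. So the
  choice below affects only values away from \<open>proj x0\<close>; \<open>crit_branch H x0\<close> and
  \<open>crit_value H x0\<close> are meaningful as germs at \<open>proj x0\<close>.\<close>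

definition crit_branch :: "(phase \<Rightarrow> real) \<Rightarrow> phase \<Rightarrow> real \<times> real \<Rightarrow> real" where
  "crit_branch H x0 = (SOME pc. is_crit_branch H x0 pc)"

fun crit_value :: "(phase \<Rightarrow> real) \<Rightarrow> phase \<Rightarrow> real \<times> real \<Rightarrow> real" where
  "crit_value H x0 (q2, p2) = H (0, q2, crit_branch H x0 (q2, p2), p2)"

end

theory Submission
  imports Defs
begin

text \<open>Write \<open>F (b, p)\<close> for \<open>H\<close> on \<open>C\<close> and \<open>\<sigma>\<close> for the sign of its second fibre derivative. Taylor's
  formula in the fibre at the critical branch gives \<open>F (b, p) = E\<^sup>c b + (p - p\<^sup>c b)\<^sup>2 K (b, p)\<close> with
  smooth \<open>K\<close> and \<open>\<sigma> K > 0\<close>, so \<open>v = (p - p\<^sup>c b) sqrt (\<sigma> K)\<close> is a smooth fibre coordinate in which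
  \<open>F = E\<^sup>c b + \<sigma> v\<^sup>2\<close>. The level set becomes \<open>v\<^sup>2 = \<sigma> (E - E\<^sup>c b)\<close>. By (T) the right-hand side can be
  taken as the second coordinate \<open>s\<close> of a chart \<open>(u, s)\<close> of the plane; then \<open>(u, v)\<close> are coordinates
  on the surface and the projection is \<open>s = v\<^sup>2\<close>. Over a small neighbourhood of \<open>b0\<close> the
  preimages of \<open>b\<close> are the square roots of \<open>\<sigma> (E - E\<^sup>c b)\<close>.\<close>

section \<open>Calculus of \<open>C\<^sup>k\<close> and smooth maps\<close>

text \<open>The one inversion result is for shears
  \<open>(x, y) \<mapsto> (x, \<phi> (x, y))\<close> with scalar \<open>y\<close>. Existence of a
  critical branch, smoothness of a given branch, the fibre coordinate and the chart of the plane are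
  all instances of it. The quotient of \<open>F (b, p) - F (b, pc b)\<close> by the square of
  \<open>p - pc b\<close> is undefined exactly on the branch, where smoothness matters; writing
  \<open>K\<close> as an integral over a segment of the fibre reduces the question to
  differentiation under the integral sign. The fold does not by itself give the count of preimages:
  its chart domains are not matched to each other, so over some \<open>b\<close> near
  \<open>b0\<close> a square root could fall outside the chart. The Morse form along the fibres is
  therefore proved once and used twice: for the fold, and for the count on neighbourhoods adapted to
  each other.\<close>

lemma Ck_on_cong:
  assumes "open S"
  shows "Ck_on k S f \<Longrightarrow> (\<And>x. x \<in> S \<Longrightarrow> f x = g x) \<Longrightarrow> Ck_on k S g"
proof (induction k arbitrary: f g)
  case 0
  then show ?case by (simp cong: continuous_on_cong)
next
  case (Suc k)
  have eq: "frechet_derivative f (at x) = frechet_derivative g (at x)"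
    and "g differentiable at x" if "x \<in> S" for x
  proof -
    have "f differentiable at x" using Suc.prems(1) that by simp
    then show "frechet_derivative f (at x) = frechet_derivative g (at x)"
      by (rule frechet_derivative_transform_within_open[OF _ assms that Suc.prems(2)])
    show "g differentiable at x"
      using \<open>f differentiable at x\<close> has_derivative_transform_within_open[of f _ x UNIV S g, OF _ assms that Suc.prems(2)]
      unfolding differentiable_def by blast
  qed
  moreover have "Ck_on k S (\<lambda>x. frechet_derivative g (at x) h)" for h
    by (rule Suc.IH[where f = "\<lambda>x. frechet_derivative f (at x) h"]) (use Suc.prems(1) eq in auto)
  ultimately show ?case by simp
qed

text \<open>By uniqueness of derivatives at points of an open set, any explicitly computed
  derivative may stand in for \<open>frechet_derivative\<close>. The inductions on \<open>k\<close>
  that follow raise the order through this rule.\<close>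

lemma Ck_on_SucI:
  assumes "open S"
    and der: "\<And>x. x \<in> S \<Longrightarrow> (f has_derivative f' x) (at x)"
    and "\<And>h. Ck_on k S (\<lambda>x. f' x h)"
  shows "Ck_on (Suc k) S f"
proof -
  have "f' x = frechet_derivative f (at x)" if "x \<in> S" for x
    using der[OF that] by (rule frechet_derivative_at)
  then have "Ck_on k S (\<lambda>x. frechet_derivative f (at x) h)" for h
    by (intro Ck_on_cong[OF assms(1) assms(3)[of h]]) simp
  then show ?thesis
    using der by (auto simp: differentiable_def)
qed

lemma Ck_on_subset: "Ck_on k S f \<Longrightarrow> T \<subseteq> S \<Longrightarrow> Ck_on k T f"
  by (induction k arbitrary: f) (auto intro: continuous_on_subset)

lemma Ck_on_SucD: "Ck_on (Suc k) S f \<Longrightarrow> Ck_on k S f"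
proof (induction k arbitrary: f)
  case 0
  then show ?case
    by (auto intro!: continuous_at_imp_continuous_on differentiable_imp_continuous_within)
next
  case (Suc k)
  then show ?case by (metis Ck_on.simps(2))
qed

lemma Ck_on_continuous: "Ck_on k S f \<Longrightarrow> continuous_on S f"
  by (induction k) (auto simp del: Ck_on.simps(2) dest: Ck_on_SucD)

lemma Ck_on_imp_has_derivative:
  "Ck_on (Suc k) S f \<Longrightarrow> x \<in> S \<Longrightarrow> (f has_derivative frechet_derivative f (at x)) (at x)"
  by (simp add: frechet_derivative_works)

lemma Ck_on_const: "open S \<Longrightarrow> Ck_on k S (\<lambda>x. c)"
proof (induction k arbitrary: c)
  case (Suc k)
  then show ?case by (intro Ck_on_SucI[where f' = "\<lambda>_ _. 0"]) auto
qed simp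

lemma Ck_on_bounded_linear:
  assumes "bounded_linear L" "open S"
  shows "Ck_on k S L"
proof (cases k)
  case 0
  then show ?thesis using assms by (simp add: linear_continuous_on)
next
  case (Suc m)
  then show ?thesis
    using assms
    by (auto simp del: Ck_on.simps intro!: Ck_on_SucI[where f' = "\<lambda>_. L"]
        bounded_linear_imp_has_derivative Ck_on_const)
qed

lemma Ck_on_bounded_linear_compose:
  assumes "bounded_linear L" "open S"
  shows "Ck_on k S f \<Longrightarrow> Ck_on k S (\<lambda>x. L (f x))"
proof (induction k arbitrary: f)
  case 0
  then show ?case using assms by (auto intro: bounded_linear.continuous_on)
next
  case (Suc k)
  show ?case
    using Suc assms
    by (intro Ck_on_SucI[where f' = "\<lambda>x h. L (frechet_derivative f (at x) h)"])
      (auto intro: bounded_linear.has_derivative simp: frechet_derivative_works)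
qed

lemma Ck_on_add:
  assumes "open S"
  shows "Ck_on k S f \<Longrightarrow> Ck_on k S g \<Longrightarrow> Ck_on k S (\<lambda>x. f x + g x)"
proof (induction k arbitrary: f g)
  case 0
  then show ?case by (auto intro: continuous_on_add)
next
  case (Suc k)
  show ?case
    using Suc assms
    by (intro Ck_on_SucI[where f' = "\<lambda>x h. frechet_derivative f (at x) h + frechet_derivative g (at x) h"])
      (auto intro: has_derivative_add simp: frechet_derivative_works)
qed

lemma Ck_on_sum:
  assumes "open S" "\<And>i. i \<in> I \<Longrightarrow> Ck_on k S (f i)"
  shows "Ck_on k S (\<lambda>x. \<Sum>i\<in>I. f i x)"
  using assms(2)
  by (induction I rule: infinite_finite_induct) (auto intro: Ck_on_const Ck_on_add assms(1))

lemma Ck_on_bounded_bilinear: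
  assumes "bounded_bilinear B" "open S"
  shows "Ck_on k S f \<Longrightarrow> Ck_on k S g \<Longrightarrow> Ck_on k S (\<lambda>x. B (f x) (g x))"
proof (induction k arbitrary: f g)
  case 0
  then show ?case using assms by (auto intro: bounded_bilinear.continuous_on)
next
  case (Suc k)
  show ?case
  proof (rule Ck_on_SucI[OF \<open>open S\<close>])
    show "((\<lambda>x. B (f x) (g x)) has_derivative
        (\<lambda>h. B (f x) (frechet_derivative g (at x) h) + B (frechet_derivative f (at x) h) (g x))) (at x)"
      if "x \<in> S" for x
      using Suc.prems that by (intro bounded_bilinear.FDERIV[OF assms(1)] Ck_on_imp_has_derivative)
    show "Ck_on k S (\<lambda>x. B (f x) (frechet_derivative g (at x) h) + B (frechet_derivative f (at x) h) (g x))" for h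
      using Suc.prems Ck_on_SucD[OF Suc.prems(1)] Ck_on_SucD[OF Suc.prems(2)]
      by (intro Ck_on_add Suc.IH assms) auto
  qed
qed

lemma Ck_on_Pair:
  assumes "open S"
  shows "Ck_on k S f \<Longrightarrow> Ck_on k S g \<Longrightarrow> Ck_on k S (\<lambda>x. (f x, g x))"
proof (induction k arbitrary: f g)
  case 0
  then show ?case by (auto intro: continuous_on_Pair)
next
  case (Suc k)
  show ?case
    using Suc assms
    by (intro Ck_on_SucI[where f' = "\<lambda>x h. (frechet_derivative f (at x) h, frechet_derivative g (at x) h)"])
      (auto intro: has_derivative_Pair simp: frechet_derivative_works)
qed

text \<open>In the chain rule the derivative of \<open>f\<close> is applied to a direction that
  varies with \<open>x\<close>, whereas \<open>Ck_on\<close> controls fixed directions only.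
  Expanding that direction in a basis, which is why \<open>g\<close> has a Euclidean codomain,
  leaves a finite sum of products of components of the derivative of \<open>g\<close> with
  derivatives of \<open>f\<close> in fixed directions composed with \<open>g\<close>.\<close>

lemma Ck_on_compose:
  fixes g :: "'a::real_normed_vector \<Rightarrow> 'b::euclidean_space"
  assumes "open S" "open T" "g ` S \<subseteq> T"
  shows "Ck_on k T f \<Longrightarrow> Ck_on k S g \<Longrightarrow> Ck_on k S (\<lambda>x. f (g x))"
proof (induction k arbitrary: f)
  case 0
  then show ?case using assms(3) by (auto intro: continuous_on_compose2)
next
  case (Suc k)
  let ?f' = "\<lambda>x. frechet_derivative f (at x)" and ?g' = "\<lambda>x. frechet_derivative g (at x)"
  show ?case
  proof (rule Ck_on_SucI[OF \<open>open S\<close>])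
    show "((\<lambda>x. f (g x)) has_derivative (\<lambda>h. \<Sum>i\<in>Basis. (?g' x h \<bullet> i) *\<^sub>R ?f' (g x) i)) (at x)" if "x \<in> S" for x
    proof -
      have f: "(f has_derivative ?f' (g x)) (at (g x))"
        using Suc.prems(1) that assms(3) by (intro Ck_on_imp_has_derivative) auto
      have g: "(g has_derivative ?g' x) (at x)"
        using Suc.prems(2) that by (intro Ck_on_imp_has_derivative) auto
      have "linear (?f' (g x))"
        using f has_derivative_linear by blast
      then have "?f' (g x) (?g' x h) = (\<Sum>i\<in>Basis. (?g' x h \<bullet> i) *\<^sub>R ?f' (g x) i)" for h
        by (subst euclidean_representation[of "?g' x h", symmetric]) (simp add: linear_sum linear_scale)
      with has_derivative_compose[OF g f] show ?thesis by simp
    qed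
    show "Ck_on k S (\<lambda>x. \<Sum>i\<in>Basis. (?g' x h \<bullet> i) *\<^sub>R ?f' (g x) i)" for h
      using Suc.prems Ck_on_SucD[OF Suc.prems(2)]
      by (intro Ck_on_sum Ck_on_bounded_bilinear[OF bounded_bilinear_scaleR] Suc.IH \<open>open S\<close>
          Ck_on_bounded_linear_compose[OF bounded_linear_inner_left]) auto
  qed
qed

text \<open>The derivative is a product of \<open>inverse\<close> with itself, so each order follows
  from the previous one. The same self-reference settles \<open>sqrt\<close> below.\<close>

lemma Ck_on_inverse: "Ck_on k (- {0}) (inverse :: real \<Rightarrow> real)"
proof (induction k)
  case 0
  then show ?case by (auto intro: continuous_on_inverse)
next
  case (Suc k)
  have "Ck_on k (- {0}) (\<lambda>x::real. - (inverse x * h * inverse x))" for h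
    by (intro Ck_on_bounded_linear_compose[OF bounded_linear_minus[OF bounded_linear_ident]]
        Ck_on_bounded_bilinear[OF bounded_bilinear_mult] Suc Ck_on_const) auto
  then show ?case
    by (intro Ck_on_SucI[where f' = "\<lambda>x h. - (inverse x * h * inverse x)"] has_derivative_inverse') auto
qed

lemma Ck_on_sqrt: "Ck_on k {0<..} sqrt"
proof (induction k)
  case 0
  then show ?case by (auto intro: continuous_on_real_sqrt)
next
  case (Suc k)
  have "Ck_on k {0<..} (\<lambda>x. inverse (sqrt x))"
    by (rule Ck_on_compose[OF _ _ _ Ck_on_inverse Suc]) auto
  then have "Ck_on k {0<..} (\<lambda>x. (inverse (sqrt x) / 2) * h)" for h
    by (intro Ck_on_bounded_bilinear[OF bounded_bilinear_mult] Ck_on_const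
         Ck_on_bounded_linear_compose[OF bounded_linear_divide]) auto
  moreover have "(sqrt has_derivative (*) (inverse (sqrt x) / 2)) (at x)" if "x \<in> {0<..}" for x
    using DERIV_real_sqrt[of x] that by (simp add: has_field_derivative_def)
  ultimately show ?case
    by (intro Ck_on_SucI) auto
qed

section \<open>Closure properties of smooth functions\<close>

lemma smooth_onD: "smooth_on S f \<Longrightarrow> Ck_on k S f"
  by (simp add: smooth_on_def)

lemma smooth_on_cong: "open S \<Longrightarrow> smooth_on S f \<Longrightarrow> (\<And>x. x \<in> S \<Longrightarrow> f x = g x) \<Longrightarrow> smooth_on S g"
  unfolding smooth_on_def using Ck_on_cong by blast

lemma smooth_on_subset: "smooth_on S f \<Longrightarrow> T \<subseteq> S \<Longrightarrow> smooth_on T f"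
  unfolding smooth_on_def using Ck_on_subset by blast

lemma smooth_on_has_derivative:
  "smooth_on S f \<Longrightarrow> x \<in> S \<Longrightarrow> (f has_derivative frechet_derivative f (at x)) (at x)"
  using Ck_on_imp_has_derivative smooth_onD by blast

lemma smooth_on_frechet_derivative: "smooth_on S f \<Longrightarrow> smooth_on S (\<lambda>x. frechet_derivative f (at x) h)"
  unfolding smooth_on_def by (metis Ck_on.simps(2))

lemma smooth_on_continuous: "smooth_on S f \<Longrightarrow> continuous_on S f"
  using smooth_onD[of S f 0] by simp

lemma smooth_on_const: "open S \<Longrightarrow> smooth_on S (\<lambda>x. c)"
  by (simp add: smooth_on_def Ck_on_const)

lemma smooth_on_bounded_linear: "bounded_linear L \<Longrightarrow> open S \<Longrightarrow> smooth_on S L"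
  by (simp add: smooth_on_def Ck_on_bounded_linear)

lemma smooth_on_bounded_linear_compose:
  "bounded_linear L \<Longrightarrow> open S \<Longrightarrow> smooth_on S f \<Longrightarrow> smooth_on S (\<lambda>x. L (f x))"
  by (simp add: smooth_on_def Ck_on_bounded_linear_compose)

lemma smooth_on_add: "open S \<Longrightarrow> smooth_on S f \<Longrightarrow> smooth_on S g \<Longrightarrow> smooth_on S (\<lambda>x. f x + g x)"
  by (simp add: smooth_on_def Ck_on_add)

lemma smooth_on_diff: "open S \<Longrightarrow> smooth_on S f \<Longrightarrow> smooth_on S g \<Longrightarrow> smooth_on S (\<lambda>x. f x - g x)"
  using smooth_on_add[of S f "\<lambda>x. - g x"]
    smooth_on_bounded_linear_compose[OF bounded_linear_minus[OF bounded_linear_ident], of S g]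
  by simp

lemma smooth_on_mult:
  fixes f g :: "'a::real_normed_vector \<Rightarrow> real"
  shows "open S \<Longrightarrow> smooth_on S f \<Longrightarrow> smooth_on S g \<Longrightarrow> smooth_on S (\<lambda>x. f x * g x)"
  by (simp add: smooth_on_def Ck_on_bounded_bilinear[OF bounded_bilinear_mult])

lemma smooth_on_Pair: "open S \<Longrightarrow> smooth_on S f \<Longrightarrow> smooth_on S g \<Longrightarrow> smooth_on S (\<lambda>x. (f x, g x))"
  by (simp add: smooth_on_def Ck_on_Pair)

lemma smooth_on_compose:
  fixes g :: "'a::real_normed_vector \<Rightarrow> 'b::euclidean_space"
  shows "open S \<Longrightarrow> open T \<Longrightarrow> smooth_on T f \<Longrightarrow> smooth_on S g \<Longrightarrow> g ` S \<subseteq> T \<Longrightarrow> smooth_on S (\<lambda>x. f (g x))"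
  unfolding smooth_on_def using Ck_on_compose by blast

lemma smooth_on_sqrt:
  "open S \<Longrightarrow> smooth_on S f \<Longrightarrow> (\<And>x. x \<in> S \<Longrightarrow> 0 < f x) \<Longrightarrow> smooth_on S (\<lambda>x. sqrt (f x))"
  by (rule smooth_on_compose[of S "{0<..}" sqrt]) (auto simp: smooth_on_def Ck_on_sqrt)

text \<open>On a finite-dimensional domain, continuity of the derivative in each basis direction
  amounts to continuity in operator norm. This is the form in which the Leibniz rule wants the
  derivative.\<close>

lemma Ck_on_frechet_blinfun:
  fixes f :: "'a::euclidean_space \<Rightarrow> 'b::real_normed_vector"
  assumes "Ck_on (Suc k) S f"
  shows Ck_on_blinfun_apply: "x \<in> S \<Longrightarrow>
      blinfun_apply (Blinfun (frechet_derivative f (at x))) = frechet_derivative f (at x)"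
    and Ck_on_continuous_blinfun: "continuous_on S (\<lambda>x. Blinfun (frechet_derivative f (at x)))"
proof -
  show app: "blinfun_apply (Blinfun (frechet_derivative f (at x))) = frechet_derivative f (at x)"
    if "x \<in> S" for x
    using Ck_on_imp_has_derivative[OF assms that]
    by (intro bounded_linear_Blinfun_apply has_derivative_bounded_linear)
  have "continuous_on S (\<lambda>x. frechet_derivative f (at x) i)" for i
    using assms by (intro Ck_on_continuous[of k]) simp
  then show "continuous_on S (\<lambda>x. Blinfun (frechet_derivative f (at x)))"
    by (intro continuous_on_blinfun_componentwise) (simp add: app cong: continuous_on_cong)
qed

text \<open>The derivative of the integral in direction \<open>h\<close> is the integral of the
  derivative of \<open>G\<close> in direction \<open>(h, 0)\<close>, again a parametric integral;
  hence the induction over all \<open>G\<close>. Convexity of \<open>D\<close> is a premise of the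
  Leibniz rule.\<close>

lemma Ck_on_parametric_integral:
  fixes G :: "'a::euclidean_space \<times> real \<Rightarrow> real"
  assumes "open D" "convex D" "D \<times> {a..b} \<subseteq> S"
  shows "Ck_on k S G \<Longrightarrow> Ck_on k D (\<lambda>x. integral {a..b} (\<lambda>t. G (x, t)))"
proof (induction k arbitrary: G)
  case 0
  then have "continuous_on (D \<times> cbox a b) (\<lambda>(x, t). G (x, t))"
    using assms(3) by (auto intro: continuous_on_subset)
  then show ?case using integral_continuous_on_param[of D a b "\<lambda>x t. G (x, t)"] by simp
next
  case (Suc k)
  let ?G' = "\<lambda>z. frechet_derivative G (at z)"
  \<comment> \<open>The partial derivative in \<open>x\<close>: the full derivative of
    \<open>G\<close> composed with the inclusion of the first factor.\<close>
  define fx where "fx x t = Blinfun (?G' (x, t)) o\<^sub>L Blinfun (\<lambda>h::'a. (h, 0::real))" for x t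
  have bl: "bounded_linear (\<lambda>h::'a. (h, 0::real))"
    by (intro bounded_linear_Pair bounded_linear_ident bounded_linear_zero)
  have in_S: "(x, t) \<in> S" if "x \<in> D" "t \<in> {a..b}" for x t
    using assms(3) that by auto
  have fx: "blinfun_apply (fx x t) = (\<lambda>h. ?G' (x, t) (h, 0))" if "x \<in> D" "t \<in> {a..b}" for x t
    using Ck_on_blinfun_apply[OF Suc.prems in_S[OF that]]
    by (auto simp: fx_def bounded_linear_Blinfun_apply[OF bl])
  have cont_fx: "continuous_on (D \<times> cbox a b) (\<lambda>(x, t). fx x t)"
    unfolding fx_def case_prod_unfold
    using continuous_on_subset[OF Ck_on_continuous_blinfun[OF Suc.prems] assms(3)]
    by (auto intro!: continuous_intros)
  have contG: "continuous_on S G"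
    using Suc.prems by (rule Ck_on_continuous)
  have der: "((\<lambda>x. integral {a..b} (\<lambda>t. G (x, t))) has_derivative
      (\<lambda>h. integral {a..b} (\<lambda>t. ?G' (x, t) (h, 0)))) (at x)" if "x \<in> D" for x
  proof -
    have "((\<lambda>x. integral (cbox a b) (\<lambda>t. G (x, t))) has_derivative
        blinfun_apply (integral (cbox a b) (fx x))) (at x within D)"
    proof (rule leibniz_rule[OF _ _ cont_fx that assms(2)])
      fix y t assume yt: "y \<in> D" "t \<in> cbox a b"
      have "((\<lambda>x. (x, t)) has_derivative (\<lambda>h. (h, 0))) (at y within D)"
        by (auto intro!: derivative_eq_intros)
      moreover have "(G has_derivative ?G' (y, t)) (at (y, t))"
        using in_S yt by (intro Ck_on_imp_has_derivative[OF Suc.prems]) simp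
      ultimately show "((\<lambda>x. G (x, t)) has_derivative blinfun_apply (fx y t)) (at y within D)"
        using has_derivative_compose[where f = "\<lambda>x. (x, t)" and g = G] yt
        by (simp add: fx)
    next
      fix y assume "y \<in> D"
      then have "continuous_on (cbox a b) (\<lambda>t. G (y, t))"
        by (intro continuous_on_compose2[OF contG] continuous_intros) (use in_S in auto)
      then show "(\<lambda>t. G (y, t)) integrable_on cbox a b"
        by (rule integrable_continuous)
    qed
    then have der: "((\<lambda>x. integral (cbox a b) (\<lambda>t. G (x, t))) has_derivative
        blinfun_apply (integral (cbox a b) (fx x))) (at x)"
      unfolding at_within_open[OF that assms(1)] .
    have "continuous_on (cbox a b) (\<lambda>t. Pair x t)"
      by (intro continuous_intros)
    then have "continuous_on (cbox a b) (fx x)"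
      using continuous_on_compose2[OF cont_fx, of "cbox a b" "Pair x"] that by auto
    then have "fx x integrable_on cbox a b"
      by (rule integrable_continuous)
    then have "blinfun_apply (integral (cbox a b) (fx x)) h = integral (cbox a b) (\<lambda>t. ?G' (x, t) (h, 0))" for h
      unfolding blinfun_apply_integral[OF \<open>fx x integrable_on cbox a b\<close>]
      using that by (intro Henstock_Kurzweil_Integration.integral_cong) (simp add: fx)
    then have eq: "blinfun_apply (integral (cbox a b) (fx x)) = (\<lambda>h. integral (cbox a b) (\<lambda>t. ?G' (x, t) (h, 0)))"
      by (rule ext)
    show ?thesis
      using der[unfolded eq] by (simp only: cbox_interval)
  qed
  show ?case
  proof (rule Ck_on_SucI[where f' = "\<lambda>x h. integral {a..b} (\<lambda>t. ?G' (x, t) (h, 0))"])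
    show "Ck_on k D (\<lambda>x. integral {a..b} (\<lambda>t. ?G' (x, t) (h, 0)))" for h
    proof (rule Suc.IH)
      show "Ck_on k S (\<lambda>z. ?G' z (h, 0))" using Suc.prems by simp
    qed
  qed (fact \<open>open D\<close>, fact der)
qed

section \<open>Local inversion and coordinates\<close>

text \<open>Maps of the form \<open>(x, y) \<mapsto> (x, \<phi> (x, y))\<close> with scalar \<open>y\<close> have an explicitly invertible
  derivative, so that smoothness of the inverse needs no determinants; \<open>\<psi>\<close> gives the inverse
  \<open>(x, t) \<mapsto> (x, \<psi> (x, t))\<close>.\<close>

lemma smooth_shear_inverse:
  fixes \<phi> :: "'a::euclidean_space \<times> real \<Rightarrow> real"
  assumes "open W" "smooth_on W \<phi>" "(x0, y0) \<in> W"
    and "frechet_derivative \<phi> (at (x0, y0)) (0, 1) \<noteq> 0"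
  obtains U V \<psi> where "open U" "(x0, y0) \<in> U" "U \<subseteq> W" "open V" "(x0, \<phi> (x0, y0)) \<in> V"
    "smooth_on V \<psi>"
    "\<And>x y. (x, y) \<in> U \<Longrightarrow> (x, \<phi> (x, y)) \<in> V \<and> \<psi> (x, \<phi> (x, y)) = y"
    "\<And>x t. (x, t) \<in> V \<Longrightarrow> (x, \<psi> (x, t)) \<in> U \<and> \<phi> (x, \<psi> (x, t)) = t"
proof -
  let ?D = "\<lambda>z. frechet_derivative \<phi> (at z)"
  \<comment> \<open>Restricting to the points where the shear has invertible derivative makes the
    formula for the derivative of the inverse valid on all of \<open>V\<close>, not only at the base
    point.\<close>
  define W' where "W' = {z \<in> W. ?D z (0, 1) \<noteq> 0}"
  have contD: "continuous_on W (\<lambda>z. ?D z (0, 1))"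
    using assms(2) smooth_on_continuous smooth_on_frechet_derivative by blast
  have "W' = W \<inter> (\<lambda>z. ?D z (0, 1)) -` (- {0})" by (auto simp: W'_def)
  then have "open W'"
    using continuous_open_preimage[OF contD \<open>open W\<close>, of "- {0}"] by (simp add: open_Compl)
  have "W' \<subseteq> W" "(x0, y0) \<in> W'" using assms by (auto simp: W'_def)
  have sm: "smooth_on W' \<phi>" using assms(2) \<open>W' \<subseteq> W\<close> smooth_on_subset by blast
  have der: "(\<phi> has_derivative ?D z) (at z)" if "z \<in> W'" for z
    using smooth_on_has_derivative[OF sm that] .
  have lin: "linear (?D z)" if "z \<in> W'" for z
    using der[OF that] has_derivative_linear by blast
  have split: "?D z (h, k) = ?D z (h, 0) + k * ?D z (0, 1)" if "z \<in> W'" for z h k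
    using linear_add[OF lin[OF that], of "(h, 0)" "(0, k)"] linear_scale[OF lin[OF that], of k "(0, 1)"]
    by simp
  define f where "f z = (fst z, \<phi> z)" for z
  define f' where "f' z = Blinfun (\<lambda>h. (fst h, ?D z h))" for z
  have bl: "bounded_linear (\<lambda>h. (fst h, ?D z h))" if "z \<in> W'" for z
    using der[OF that] by (intro bounded_linear_Pair bounded_linear_fst has_derivative_bounded_linear)
  have f': "blinfun_apply (f' z) = (\<lambda>h. (fst h, ?D z h))" if "z \<in> W'" for z
    by (simp add: f'_def bounded_linear_Blinfun_apply bl[OF that])
  have derf: "(f has_derivative blinfun_apply (f' z)) (at z)" if "z \<in> W'" for z
    unfolding f_def f'[OF that] using der[OF that]
    by (intro has_derivative_Pair has_derivative_fst has_derivative_ident)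
  have contf: "continuous_on W' f'"
  proof (rule continuous_on_blinfun_componentwise)
    fix i :: "'a \<times> real"
    have "continuous_on W' (\<lambda>z. (fst i, ?D z i))"
      by (intro continuous_intros smooth_on_continuous[OF smooth_on_frechet_derivative[OF sm]])
    then show "continuous_on W' (\<lambda>z. blinfun_apply (f' z) i)"
      by (rule continuous_on_eq) (simp add: f')
  qed
  let ?z0 = "(x0, y0)"
  \<comment> \<open>The solution \<open>(h, k)\<close> of the triangular system
    \<open>h = fst w\<close>, \<open>?D ?z0 (h, 0) + k * ?D ?z0 (0, 1) = snd w\<close>.\<close>
  define invf where "invf = Blinfun (\<lambda>w::'a \<times> real. (fst w, (snd w - ?D ?z0 (fst w, 0)) / ?D ?z0 (0, 1)))"
  have bl_z0: "bounded_linear (?D ?z0)"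
    using der[OF \<open>?z0 \<in> W'\<close>] by (rule has_derivative_bounded_linear)
  have "bounded_linear (\<lambda>w::'a \<times> real. ?D ?z0 (fst w, 0))"
    by (rule bounded_linear_compose[OF bl_z0])
      (intro bounded_linear_Pair bounded_linear_fst bounded_linear_zero)
  then have "bounded_linear (\<lambda>w::'a \<times> real. snd w - ?D ?z0 (fst w, 0))"
    by (rule bounded_linear_sub[OF bounded_linear_snd])
  then have "bounded_linear (\<lambda>w::'a \<times> real. (snd w - ?D ?z0 (fst w, 0)) / ?D ?z0 (0, 1))"
    by (rule bounded_linear_compose[OF bounded_linear_divide])
  then have "bounded_linear (\<lambda>w::'a \<times> real. (fst w, (snd w - ?D ?z0 (fst w, 0)) / ?D ?z0 (0, 1)))"
    by (rule bounded_linear_Pair[OF bounded_linear_fst])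
  then have "blinfun_apply invf = (\<lambda>w. (fst w, (snd w - ?D ?z0 (fst w, 0)) / ?D ?z0 (0, 1)))"
    by (simp add: invf_def bounded_linear_Blinfun_apply)
  then have "blinfun_apply (invf o\<^sub>L f' ?z0) w = w" for w
    using assms(4) split[OF \<open>?z0 \<in> W'\<close>, of "fst w" "snd w"]
    by (simp add: f'[OF \<open>?z0 \<in> W'\<close>])
  then have inv: "invf o\<^sub>L f' ?z0 = id_blinfun"
    by (intro blinfun_eqI) simp
  have "\<exists>U V g g'. open U \<and> U \<subseteq> W' \<and> ?z0 \<in> U \<and> open V \<and> f ?z0 \<in> V \<and>
      homeomorphism U V f g \<and> (\<forall>y\<in>V. (g has_derivative (g' y)) (at y))"
  proof (rule inverse_function_theorem[OF \<open>open W'\<close> _ contf \<open>?z0 \<in> W'\<close> inv])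
    show "(f has_derivative blinfun_apply (f' z)) (at z)" if "z \<in> W'" for z
      using that by (rule derf)
  qed blast
  then obtain U V g g' where U: "open U" "U \<subseteq> W'" "?z0 \<in> U" and V: "open V" "f ?z0 \<in> V"
    and hom: "homeomorphism U V f g"
    and derg: "\<And>y. y \<in> V \<Longrightarrow> (g has_derivative (g' y)) (at y)"
    by blast
  define \<psi> where "\<psi> z = snd (g z)" for z
  have g: "g z = (fst z, \<psi> z)" "g z \<in> U" "\<phi> (g z) = snd z" if "z \<in> V" for z
  proof -
    have "f (g z) = z" "g z \<in> U" using hom that unfolding homeomorphism_def by auto
    then show "g z = (fst z, \<psi> z)" "g z \<in> U" "\<phi> (g z) = snd z"
      by (auto simp: f_def \<psi>_def prod_eq_iff)
  qed
  \<comment> \<open>Implicit differentiation: the inverse function theorem gives some derivative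
    \<open>g'\<close>, and differentiating the identity
    \<open>\<phi> (fst z, \<psi> z) = snd z\<close> on \<open>V\<close> determines its second
    component.\<close>
  have der\<psi>: "(\<psi> has_derivative (\<lambda>h. (snd h - ?D (g z) (fst h, 0)) / ?D (g z) (0, 1))) (at z)" if "z \<in> V" for z
  proof -
    have d: "(\<psi> has_derivative (\<lambda>h. snd (g' z h))) (at z)"
      unfolding \<psi>_def by (intro has_derivative_snd derg that)
    have "((\<lambda>z. (fst z, \<psi> z)) has_derivative (\<lambda>h. (fst h, snd (g' z h)))) (at z)"
      by (intro has_derivative_Pair has_derivative_fst has_derivative_ident d)
    moreover have gz: "(fst z, \<psi> z) \<in> W'" using g(1,2)[OF that] U(2) by auto
    ultimately have "((\<lambda>z. \<phi> (fst z, \<psi> z)) has_derivative (\<lambda>h. ?D (fst z, \<psi> z) (fst h, snd (g' z h)))) (at z)"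
      by (rule has_derivative_compose[OF _ der])
    then have "(snd has_derivative (\<lambda>h. ?D (fst z, \<psi> z) (fst h, snd (g' z h)))) (at z)"
      by (rule has_derivative_transform_within_open[OF _ V(1) that]) (metis g(1,3))
    moreover have "(snd has_derivative snd) (at z)"
      by (intro bounded_linear_imp_has_derivative bounded_linear_snd)
    ultimately have "(\<lambda>h. ?D (fst z, \<psi> z) (fst h, snd (g' z h))) = snd"
      by (rule has_derivative_unique)
    then have "?D (g z) (fst h, 0) + snd (g' z h) * ?D (g z) (0, 1) = snd h" for h
      using split[OF gz] g(1)[OF that] by (metis (no_types))
    moreover have "?D (g z) (0, 1) \<noteq> 0" using g(2)[OF that] U(2) by (auto simp: W'_def)
    ultimately have "(snd h - ?D (g z) (fst h, 0)) / ?D (g z) (0, 1) = snd (g' z h)" for h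
      by (metis add_diff_cancel_left' nonzero_eq_divide_eq)
    with d show ?thesis by simp
  qed
  \<comment> \<open>Bootstrapping: the derivative of \<open>\<psi>\<close> is a rational expression
    in derivatives of \<open>\<phi>\<close> taken at \<open>g z\<close>. If \<open>\<psi>\<close>,
    hence \<open>g\<close>, has order \<open>k\<close>, so does this derivative, and
    \<open>\<psi>\<close> has order \<open>k + 1\<close>.\<close>
  have "Ck_on k V \<psi>" for k
  proof (induction k)
    case 0
    have "continuous_on V g" using hom by (simp add: homeomorphism_def)
    then show ?case by (auto simp: \<psi>_def intro: continuous_on_snd)
  next
    case (Suc k)
    have "Ck_on k V (\<lambda>z. (fst z, \<psi> z))"
      by (intro Ck_on_Pair V(1) Suc Ck_on_bounded_linear bounded_linear_fst)
    then have "Ck_on k V g"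
      by (rule Ck_on_cong[OF V(1)]) (simp add: g)
    moreover have "g ` V \<subseteq> W'" using g(2) U(2) by blast
    ultimately have D: "Ck_on k V (\<lambda>z. ?D (g z) h)" for h
      by (intro Ck_on_compose[OF V(1) \<open>open W'\<close> _ smooth_onD[OF smooth_on_frechet_derivative[OF sm]]])
    have I: "Ck_on k V (\<lambda>z. inverse (?D (g z) (0, 1)))"
    proof (rule Ck_on_compose[OF V(1) _ _ Ck_on_inverse D[of "(0, 1)"]])
      have "?D (g z) (0, 1) \<noteq> 0" if "z \<in> V" for z
        using g(2)[OF that] U(2) by (auto simp: W'_def)
      then show "(\<lambda>z. ?D (g z) (0, 1)) ` V \<subseteq> - {0}"
        by (intro image_subsetI) simp
    qed (simp add: open_Compl)
    have "Ck_on k V (\<lambda>z. (snd h + - ?D (g z) (fst h, 0)) * inverse (?D (g z) (0, 1)))" for h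
      by (intro Ck_on_bounded_bilinear[OF bounded_bilinear_mult] Ck_on_add V(1) Ck_on_const I
          Ck_on_bounded_linear_compose[OF bounded_linear_minus[OF bounded_linear_ident]] D)
    then have "Ck_on k V (\<lambda>z. (snd h - ?D (g z) (fst h, 0)) / ?D (g z) (0, 1))" for h
      by (simp add: divide_inverse)
    with der\<psi> show ?case by (rule Ck_on_SucI[OF V(1)])
  qed
  then have "smooth_on V \<psi>" by (simp add: smooth_on_def)
  show thesis
  proof (rule that[OF U(1,3) _ V(1) _ \<open>smooth_on V \<psi>\<close>])
    show "U \<subseteq> W" "(x0, \<phi> (x0, y0)) \<in> V" using U V \<open>W' \<subseteq> W\<close> by (auto simp: f_def)
    show "(x, \<phi> (x, y)) \<in> V \<and> \<psi> (x, \<phi> (x, y)) = y" if "(x, y) \<in> U" for x y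
    proof -
      have "g (f (x, y)) = (x, y)" "f (x, y) \<in> V" using hom that unfolding homeomorphism_def by auto
      then show ?thesis by (simp add: f_def \<psi>_def)
    qed
    show "(x, \<psi> (x, t)) \<in> U \<and> \<phi> (x, \<psi> (x, t)) = t" if "(x, t) \<in> V" for x t
      using g[OF that] by auto
  qed
qed

text \<open>A nonzero differential has a nonzero partial derivative, so \<open>e\<close> together
  with one of the two standard coordinates is a chart. The second coordinate is kept equal to
  \<open>e\<close> without translation, so that later it is literally the squared fibre coordinate
  on the level set.\<close>

lemma plane_coordinates_exist:
  fixes e :: "real \<times> real \<Rightarrow> real"
  assumes "open B" "smooth_on B e" "b0 \<in> B" and D: "frechet_derivative e (at b0) \<noteq> (\<lambda>_. 0)"
  obtains (coords) V T and \<theta> \<tau> :: "real \<times> real \<Rightarrow> real \<times> real" where "open V" "b0 \<in> V" "V \<subseteq> B" "open T" "smooth_on V \<theta>" "smooth_on T \<tau>"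
    "\<theta> b0 = (0, e b0)" "\<And>b. snd (\<theta> b) = e b"
    "\<And>b. b \<in> V \<Longrightarrow> \<theta> b \<in> T \<and> \<tau> (\<theta> b) = b"
    "\<And>w. w \<in> T \<Longrightarrow> \<tau> w \<in> V \<and> \<theta> (\<tau> w) = w"
proof -
  \<comment> \<open>Common end of both cases: an uncentred chart \<open>(\<eta>, e)\<close> is
    translated by \<open>\<eta> b0\<close> in its first coordinate only.\<close>
  have finish: thesis
    if V: "open V" "b0 \<in> V" "V \<subseteq> B" and T: "open T" and sm: "smooth_on V \<eta>" "smooth_on T \<tau>"
      and fw: "\<And>b. b \<in> V \<Longrightarrow> (\<eta> b, e b) \<in> T \<and> \<tau> (\<eta> b, e b) = b"
      and bw: "\<And>w. w \<in> T \<Longrightarrow> \<tau> w \<in> V \<and> \<eta> (\<tau> w) = fst w \<and> e (\<tau> w) = snd w"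
    for V T \<tau> and \<eta> :: "real \<times> real \<Rightarrow> real"
  proof -
    let ?s = "\<lambda>w. w + (\<eta> b0, 0)"
    have sT: "open (?s -` T)"
      using T by (intro open_vimage continuous_intros)
    have "smooth_on (?s -` T) ?s"
      by (intro smooth_on_add smooth_on_const sT smooth_on_bounded_linear bounded_linear_ident)
    then have sm\<tau>: "smooth_on (?s -` T) (\<lambda>w. \<tau> (?s w))"
      by (intro smooth_on_compose[OF sT T sm(2)]) auto
    have sm\<theta>: "smooth_on V (\<lambda>b. (\<eta> b - \<eta> b0, e b))"
      by (intro smooth_on_Pair smooth_on_diff smooth_on_const V(1) sm(1) smooth_on_subset[OF assms(2) V(3)])
    show thesis
    proof (rule coords[OF V sT sm\<theta> sm\<tau>])
      show "(\<eta> b - \<eta> b0, e b) \<in> ?s -` T \<and> \<tau> (?s (\<eta> b - \<eta> b0, e b)) = b" if "b \<in> V" for b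
        using fw[OF that] by simp
      show "\<tau> (?s w) \<in> V \<and> (\<eta> (\<tau> (?s w)) - \<eta> b0, e (\<tau> (?s w))) = w" if "w \<in> ?s -` T" for w
        using bw[of "?s w"] that by (simp add: prod_eq_iff)
    qed simp_all
  qed
  show thesis
  proof (cases "frechet_derivative e (at b0) (0, 1) = 0")
    case False
    obtain x0 y0 where b0: "b0 = (x0, y0)" by (cases b0)
    obtain U V \<psi> where U: "open U" "b0 \<in> U" "U \<subseteq> B" and V: "open V" "smooth_on V \<psi>"
      and \<psi>: "\<And>x y. (x, y) \<in> U \<Longrightarrow> (x, e (x, y)) \<in> V \<and> \<psi> (x, e (x, y)) = y"
        "\<And>x t. (x, t) \<in> V \<Longrightarrow> (x, \<psi> (x, t)) \<in> U \<and> e (x, \<psi> (x, t)) = t"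
      using smooth_shear_inverse[OF assms(1,2,3)[unfolded b0] False[unfolded b0], folded b0] by metis
    have sm\<tau>: "smooth_on V (\<lambda>w. (fst w, \<psi> w))"
      by (intro smooth_on_Pair V smooth_on_bounded_linear bounded_linear_fst)
    have sm\<eta>: "smooth_on U fst"
      by (intro smooth_on_bounded_linear bounded_linear_fst U)
    have fw: "(fst b, e b) \<in> V \<and> (fst (fst b, e b), \<psi> (fst b, e b)) = b" if "b \<in> U" for b
      using \<psi>(1)[of "fst b" "snd b"] that by simp
    have bw: "(fst w, \<psi> w) \<in> U \<and> fst (fst w, \<psi> w) = fst w \<and> e (fst w, \<psi> w) = snd w" if "w \<in> V" for w
      using \<psi>(2)[of "fst w" "snd w"] that by simp
    show thesis by (rule finish[OF U V(1) sm\<eta> sm\<tau> fw bw])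
  next
    case True
    let ?D = "frechet_derivative e (at b0)"
    obtain x0 y0 where b0: "b0 = (x0, y0)" by (cases b0)
    have e: "(e has_derivative ?D) (at b0)"
      using smooth_on_has_derivative[OF assms(2,3)] .
    then have lin: "linear ?D" by (rule has_derivative_linear)
    have D10: "?D (1, 0) \<noteq> 0"
    proof
      assume "?D (1, 0) = 0"
      then have "?D h = 0" for h
        using True linear_add[OF lin, of "(fst h, 0)" "(0, snd h)"]
          linear_scale[OF lin, of "fst h" "(1, 0)"] linear_scale[OF lin, of "snd h" "(0, 1)"] by simp
      with D show False by auto
    qed
    have sw: "bounded_linear (prod.swap :: real \<times> real \<Rightarrow> _)"
      unfolding prod.swap_def by (intro bounded_linear_Pair bounded_linear_fst bounded_linear_snd)
    \<comment> \<open>Here \<open>e\<close> varies in the first variable. Swapping the variables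
      restores the shear form, and \<open>snd\<close> becomes the first chart coordinate.\<close>
    let ?B = "prod.swap -` B" and ?e = "\<lambda>z. e (prod.swap z)"
    have B: "open ?B"
      using assms(1) sw by (intro open_vimage linear_continuous_on)
    have sme: "smooth_on ?B ?e"
      by (rule smooth_on_compose[OF B assms(1,2) smooth_on_bounded_linear[OF sw B]]) auto
    have in_B: "(y0, x0) \<in> ?B" using assms(3) b0 by simp
    have "(prod.swap has_derivative prod.swap) (at (y0, x0))"
      using sw by (rule bounded_linear_imp_has_derivative)
    then have "(?e has_derivative (\<lambda>h. ?D (prod.swap h))) (at (y0, x0))"
      by (rule has_derivative_compose[where g = e]) (use e b0 in simp)
    then have "frechet_derivative ?e (at (y0, x0)) = (\<lambda>h. ?D (prod.swap h))"
      by (rule frechet_derivative_at[symmetric])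
    with D10 have "frechet_derivative ?e (at (y0, x0)) (0, 1) \<noteq> 0" by simp
    then obtain U V \<psi> where U: "open U" "(y0, x0) \<in> U" "U \<subseteq> ?B" and V: "open V" "smooth_on V \<psi>"
      and \<psi>: "\<And>x y. (x, y) \<in> U \<Longrightarrow> (x, ?e (x, y)) \<in> V \<and> \<psi> (x, ?e (x, y)) = y"
        "\<And>x t. (x, t) \<in> V \<Longrightarrow> (x, \<psi> (x, t)) \<in> U \<and> ?e (x, \<psi> (x, t)) = t"
      using smooth_shear_inverse[OF B sme in_B] by metis
    have oU: "open (prod.swap -` U)"
      using U(1) sw by (intro open_vimage linear_continuous_on)
    have sm\<tau>: "smooth_on V (\<lambda>w. (\<psi> w, fst w))"
      by (intro smooth_on_Pair V smooth_on_bounded_linear bounded_linear_fst)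
    have sm\<eta>: "smooth_on (prod.swap -` U) snd"
      by (intro smooth_on_bounded_linear bounded_linear_snd oU)
    have sub: "prod.swap -` U \<subseteq> B" using U(3) by force
    have mem: "b0 \<in> prod.swap -` U" using U(2) b0 by simp
    have fw: "(snd b, e b) \<in> V \<and> (\<psi> (snd b, e b), fst (snd b, e b)) = b" if "b \<in> prod.swap -` U" for b
      using \<psi>(1)[of "snd b" "fst b"] that by (simp add: prod.swap_def)
    have bw: "(\<psi> w, fst w) \<in> prod.swap -` U \<and> snd (\<psi> w, fst w) = fst w \<and> e (\<psi> w, fst w) = snd w"
      if "w \<in> V" for w
      using \<psi>(2)[of "fst w" "snd w"] that by simp
    show thesis by (rule finish[OF oU mem sub V(1) sm\<eta> sm\<tau> fw bw])
  qed
qed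

text \<open>An explicit inverse on an open set \<open>T\<close> identifies the image with
  \<open>T\<close> and \<open>inv_into\<close> with \<open>\<tau>\<close>; the maps
  \<open>\<phi>\<close> and \<open>\<tau>\<close> then serve as their own smooth extensions.\<close>

lemma local_coordinatesI:
  assumes "open U" "x \<in> S \<inter> U" "open T" "smooth_on U \<phi>" "smooth_on T \<tau>" "\<phi> x = (0, 0)"
    and fw: "\<And>y. y \<in> S \<inter> U \<Longrightarrow> \<phi> y \<in> T \<and> \<tau> (\<phi> y) = y"
    and bw: "\<And>w. w \<in> T \<Longrightarrow> \<tau> w \<in> S \<inter> U \<and> \<phi> (\<tau> w) = w"
  shows "local_coordinates S x U \<phi>"
proof -
  have im: "\<phi> ` (S \<inter> U) = T"
  proof
    show "\<phi> ` (S \<inter> U) \<subseteq> T" using fw by blast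
    show "T \<subseteq> \<phi> ` (S \<inter> U)" using bw by (metis image_eqI subsetI)
  qed
  have inj: "inj_on \<phi> (S \<inter> U)" by (rule inj_on_inverseI[where g = \<tau>]) (use fw in blast)
  have "inv_into (S \<inter> U) \<phi> w = \<tau> w" if "w \<in> T" for w
    using bw[OF that] by (intro inv_into_f_eq[OF inj]) auto
  then have "smooth_map_on T (inv_into (S \<inter> U) \<phi>)"
    unfolding smooth_map_on_def using assms(3,5) by blast
  moreover have "smooth_map_on (S \<inter> U) \<phi>"
    unfolding smooth_map_on_def using assms(1,4) by blast
  ultimately show ?thesis
    unfolding local_coordinates_def diffeo_onto_image_def im using assms(1,2,3,6) inj by blast
qed

section \<open>Normal form near a nondegenerate critical point of the fibre\<close>

text \<open>With \<open>\<psi>\<close> from the inverted shear,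
  \<open>b \<mapsto> \<psi> (b, 0)\<close> solves the equation. Existence has to be known before the
  branch defined by \<open>SOME\<close> has any property.\<close>

lemma smooth_branch_exists:
  fixes \<phi> :: "'a::euclidean_space \<times> real \<Rightarrow> real"
  assumes "open W" "smooth_on W \<phi>" "(b0, y0) \<in> W" "\<phi> (b0, y0) = 0"
    and "frechet_derivative \<phi> (at (b0, y0)) (0, 1) \<noteq> 0"
  obtains B pc where "open B" "b0 \<in> B" "smooth_on B pc" "pc b0 = y0"
    "\<And>b. b \<in> B \<Longrightarrow> (b, pc b) \<in> W \<and> \<phi> (b, pc b) = 0"
proof -
  obtain U V \<psi> where U: "open U" "(b0, y0) \<in> U" "U \<subseteq> W" and V: "open V" "(b0, \<phi> (b0, y0)) \<in> V"
    and \<psi>: "smooth_on V \<psi>"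
      "\<And>x y. (x, y) \<in> U \<Longrightarrow> (x, \<phi> (x, y)) \<in> V \<and> \<psi> (x, \<phi> (x, y)) = y"
      "\<And>x t. (x, t) \<in> V \<Longrightarrow> (x, \<psi> (x, t)) \<in> U \<and> \<phi> (x, \<psi> (x, t)) = t"
    using smooth_shear_inverse[OF assms(1,2,3,5)] by metis
  have bl: "bounded_linear (\<lambda>b::'a. (b, 0::real))"
    by (intro bounded_linear_Pair bounded_linear_ident bounded_linear_zero)
  let ?B = "(\<lambda>b. (b, 0)) -` V"
  have "open ?B" using V(1) by (intro open_vimage continuous_intros)
  have sm: "smooth_on ?B (\<lambda>b. \<psi> (b, 0))"
    by (rule smooth_on_compose[OF \<open>open ?B\<close> V(1) \<psi>(1) smooth_on_bounded_linear[OF bl \<open>open ?B\<close>]]) auto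
  show thesis
  proof (rule that[OF \<open>open ?B\<close> _ sm])
    show "b0 \<in> ?B" "\<psi> (b0, 0) = y0" using V(2) \<psi>(2)[OF U(2)] assms(4) by simp_all
    show "(b, \<psi> (b, 0)) \<in> W \<and> \<phi> (b, \<psi> (b, 0)) = 0" if "b \<in> ?B" for b
      using \<psi>(3)[of b 0] that U(3) by auto
  qed
qed

text \<open>The critical branch of the statement is selected by choice among continuous branches; this
  makes it smooth.\<close>

lemma continuous_branch_smooth:
  fixes \<phi> :: "'a::euclidean_space \<times> real \<Rightarrow> real"
  assumes "open W" "smooth_on W \<phi>" "(b0, pc b0) \<in> W"
    and "frechet_derivative \<phi> (at (b0, pc b0)) (0, 1) \<noteq> 0"
    and "open B" "b0 \<in> B" "continuous_on B pc"
    and zero: "\<forall>b\<in>B. (b, pc b) \<in> W \<longrightarrow> \<phi> (b, pc b) = 0"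
  obtains B' where "open B'" "b0 \<in> B'" "B' \<subseteq> B" "smooth_on B' pc" "\<And>b. b \<in> B' \<Longrightarrow> (b, pc b) \<in> W"
proof -
  obtain U V \<psi> where U: "open U" "(b0, pc b0) \<in> U" "U \<subseteq> W" and V: "open V"
    and \<psi>: "smooth_on V \<psi>"
      "\<And>x y. (x, y) \<in> U \<Longrightarrow> (x, \<phi> (x, y)) \<in> V \<and> \<psi> (x, \<phi> (x, y)) = y"
    using smooth_shear_inverse[OF assms(1-4)] by metis
  have bl: "bounded_linear (\<lambda>b::'a. (b, 0::real))"
    by (intro bounded_linear_Pair bounded_linear_ident bounded_linear_zero)
  \<comment> \<open>Continuity of \<open>pc\<close> makes this set open. On it the graph of
    \<open>pc\<close> stays where the shear is injective, which forces
    \<open>pc b = \<psi> (b, 0)\<close>.\<close>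
  let ?B' = "B \<inter> (\<lambda>b. (b, pc b)) -` U"
  have "open ?B'"
    using assms(5,7) U(1) by (intro continuous_open_preimage continuous_intros)
  have *: "(b, 0) \<in> V" "\<psi> (b, 0) = pc b" if "b \<in> ?B'" for b
    using \<psi>(2)[of b "pc b"] bspec[OF zero, of b] that U(3) by auto
  have "smooth_on ?B' (\<lambda>b. \<psi> (b, 0))"
    by (rule smooth_on_compose[OF \<open>open ?B'\<close> V \<psi>(1) smooth_on_bounded_linear[OF bl \<open>open ?B'\<close>]])
      (use * in auto)
  then have sm: "smooth_on ?B' pc"
    by (rule smooth_on_cong[OF \<open>open ?B'\<close>]) (use * in auto)
  show thesis
  proof (rule that[OF \<open>open ?B'\<close> _ _ sm])
    show "b0 \<in> ?B'" using U(2) assms(6) by simp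
    show "(b, pc b) \<in> W" if "b \<in> ?B'" for b using that U(3) by auto
  qed auto
qed

text \<open>\<open>K\<close> is the integral remainder of Taylor's formula, hence smooth.\<close>

lemma critical_point_factorization:
  fixes F :: "'a::euclidean_space \<times> real \<Rightarrow> real"
  defines "Fp \<equiv> \<lambda>z. frechet_derivative F (at z) (0, 1)"
  defines "Fpp \<equiv> \<lambda>z. frechet_derivative Fp (at z) (0, 1)"
  assumes "open W" "smooth_on W F" "open B" "b0 \<in> B" "smooth_on B pc"
    and crit: "\<forall>b\<in>B. (b, pc b) \<in> W \<and> Fp (b, pc b) = 0"
  obtains D K where "open D" "(b0, pc b0) \<in> D" "D \<subseteq> W \<inter> B \<times> UNIV" "smooth_on D K"
    "K (b0, pc b0) = Fpp (b0, pc b0) / 2"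
    "\<And>b p. (b, p) \<in> D \<Longrightarrow> F (b, p) = F (b, pc b) + (p - pc b)\<^sup>2 * K (b, p)"
proof -
  have smFp: "smooth_on W Fp" unfolding Fp_def by (rule smooth_on_frechet_derivative[OF assms(4)])
  have smFpp: "smooth_on W Fpp" unfolding Fpp_def by (rule smooth_on_frechet_derivative[OF smFp])
  have "(b0, pc b0) \<in> W" using crit assms(6) by blast
  then obtain r where r: "r > 0" "ball (b0, pc b0) r \<subseteq> W"
    using \<open>open W\<close> open_contains_ball by blast
  \<comment> \<open>\<open>?c z\<close> is the critical point in the fibre of \<open>z\<close>. Over
    \<open>?Q\<close> both \<open>z\<close> and \<open>?c z\<close> lie in one ball inside
    \<open>W\<close>, so by convexity the segment joining them stays in \<open>W\<close>.\<close>
  let ?A = "ball (b0, pc b0) r" and ?c = "\<lambda>z::'a \<times> real. (fst z, pc (fst z))"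
  let ?Q = "(B \<times> UNIV) \<inter> ?c -` ?A \<inter> ?A"
  have "open (B \<times> (UNIV :: real set))" using assms(5) by (simp add: open_Times)
  moreover have "continuous_on (B \<times> (UNIV :: real set)) ?c"
    by (intro continuous_intros continuous_on_compose2[OF smooth_on_continuous[OF assms(7)]]) auto
  ultimately have "open ?Q"
    by (intro open_Int continuous_open_preimage) auto
  moreover have "(b0, pc b0) \<in> ?Q" using r assms(6) by auto
  ultimately obtain d where d: "d > 0" "ball (b0, pc b0) d \<subseteq> ?Q"
    using open_contains_ball by blast
  define D where "D = ball (b0, pc b0) d"
  have D: "open D" "convex D" "(b0, pc b0) \<in> D" "D \<subseteq> ?Q" using d by (auto simp: D_def)
  \<comment> \<open>The point with parameter \<open>t\<close> on the fibre segment from the critical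
    point \<open>(b, pc b)\<close> to \<open>(b, p)\<close>.\<close>
  define g where "g z = (fst (fst z), pc (fst (fst z)) + snd z * (snd (fst z) - pc (fst (fst z))))"
    for z :: "('a \<times> real) \<times> real"
  let ?T = "(B \<times> (UNIV :: real set)) \<times> (UNIV :: real set)"
  have T: "open ?T" using assms(5) by (simp add: open_Times)
  have l1: "smooth_on ?T (\<lambda>z. fst (fst z))" and l2: "smooth_on ?T (\<lambda>z. snd (fst z))"
    and l3: "smooth_on ?T snd"
    by (intro smooth_on_bounded_linear T bounded_linear_fst_comp bounded_linear_snd_comp
        bounded_linear_fst bounded_linear_snd)+
  have l4: "smooth_on ?T (\<lambda>z. pc (fst (fst z)))"
    by (rule smooth_on_compose[OF T assms(5,7) l1]) auto
  have smg: "smooth_on ?T g"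
    unfolding g_def
    by (intro smooth_on_Pair smooth_on_add smooth_on_mult smooth_on_diff T l1 l2 l3 l4)
  define S where "S = ?T \<inter> g -` W"
  have "open S" unfolding S_def
    using smooth_on_continuous[OF smg] T assms(3) by (rule continuous_open_preimage)
  define G where "G z = (1 - snd z) * Fpp (g z)" for z
  have smG: "smooth_on S G"
    unfolding G_def
    by (intro smooth_on_mult smooth_on_diff smooth_on_const \<open>open S\<close> smooth_on_compose[OF \<open>open S\<close> assms(3) smFpp]
        smooth_on_subset[OF l3] smooth_on_subset[OF smg]) (auto simp: S_def)
  have gW: "g ((b, p), t) \<in> W" if "(b, p) \<in> D" "t \<in> {0..1}" for b p t
  proof -
    have "(b, pc b) \<in> ?A" "(b, p) \<in> ?A" using that(1) D(4) by auto
    then have "(1 - t) *\<^sub>R (b, pc b) + t *\<^sub>R (b, p) \<in> ?A"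
      using convex_ball[of "(b0, pc b0)" r] that(2) by (simp only: convex_alt atLeastAtMost_iff)
    moreover have "(1 - t) *\<^sub>R (b, pc b) + t *\<^sub>R (b, p) = g ((b, p), t)"
      by (simp add: g_def algebra_simps flip: scaleR_add_left)
    ultimately show ?thesis using r by auto
  qed
  have DS: "D \<times> {0..1} \<subseteq> S"
    using D(4) gW by (auto simp: S_def)
  define K where "K z = integral {0..1} (\<lambda>t. G (z, t))" for z
  have smK: "smooth_on D K"
    unfolding K_def smooth_on_def
    using Ck_on_parametric_integral[OF D(1,2) DS] smooth_onD[OF smG] by blast
  \<comment> \<open>At the critical point the segment is constant, and the factor one half is the
    integral of \<open>1 - t\<close> over the unit interval.\<close>
  have Kb0: "K (b0, pc b0) = Fpp (b0, pc b0) / 2"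
  proof -
    have "((\<lambda>t. (1 - t) * Fpp (b0, pc b0)) has_integral
        (1 - 1\<^sup>2 / 2) * Fpp (b0, pc b0) - (0 - 0\<^sup>2 / 2) * Fpp (b0, pc b0)) {0..1}"
      by (rule fundamental_theorem_of_calculus)
        (auto intro!: derivative_eq_intros simp flip: has_real_derivative_iff_has_vector_derivative)
    moreover have "K (b0, pc b0) = integral {0..1} (\<lambda>t. (1 - t) * Fpp (b0, pc b0))"
      by (simp only: K_def G_def g_def fst_conv snd_conv diff_self mult_zero_right add_0_right)
    ultimately show ?thesis
      by (simp only: integral_unique) simp
  qed
  have taylor: "F (b, p) = F (b, pc b) + (p - pc b)\<^sup>2 * K (b, p)" if bp: "(b, p) \<in> D" for b p
  proof -
    let ?c = "p - pc b" and ?l = "\<lambda>t. (b, pc b + t * (p - pc b))"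
    have along: "((\<lambda>t. f (?l t)) has_real_derivative ?c * frechet_derivative f (at (?l t)) (0, 1)) (at t)"
      if "smooth_on W f" "t \<in> {0..1}" for f :: "'a \<times> real \<Rightarrow> real" and t
    proof -
      have d: "(f has_derivative frechet_derivative f (at (?l t))) (at (?l t))"
        using smooth_on_has_derivative[OF that(1)] gW[OF bp that(2)] by (simp add: g_def)
      have "(?l has_derivative (\<lambda>h. (0, h * ?c))) (at t)"
        by (auto intro!: derivative_eq_intros)
      from has_derivative_compose[OF this d]
      have "((\<lambda>t. f (?l t)) has_derivative (\<lambda>h. frechet_derivative f (at (?l t)) (0, h * ?c))) (at t)" .
      moreover have "frechet_derivative f (at (?l t)) (0, h * ?c) = ?c * frechet_derivative f (at (?l t)) (0, 1) * h" for h
        using linear_scale[OF has_derivative_linear[OF d], of "h * ?c" "(0, 1)"] by simp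
      ultimately show ?thesis by (simp add: has_field_derivative_def)
    qed
    \<comment> \<open>An antiderivative that already contains the integration by parts:
      differentiating \<open>1 - t\<close> cancels the derivative of the second summand. The value
      at 1 is \<open>F (b, p)\<close>; at 0 the first summand vanishes by criticality.\<close>
    let ?\<Phi> = "\<lambda>t. (1 - t) * (?c * Fp (?l t)) + F (?l t)"
    have "((\<lambda>t. ?c\<^sup>2 * G ((b, p), t)) has_integral ?\<Phi> 1 - ?\<Phi> 0) {0..1}"
    proof (rule fundamental_theorem_of_calculus)
      fix t :: real assume t: "t \<in> {0..1}"
      have "((\<lambda>t. F (?l t)) has_real_derivative ?c * Fp (?l t)) (at t)"
        using along[OF assms(4) t] by (simp add: Fp_def)
      moreover have "((\<lambda>t. Fp (?l t)) has_real_derivative ?c * Fpp (?l t)) (at t)"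
        using along[OF smFp t] by (simp add: Fpp_def)
      ultimately have "(?\<Phi> has_real_derivative ?c\<^sup>2 * G ((b, p), t)) (at t)"
        by (auto intro!: derivative_eq_intros simp: G_def g_def power2_eq_square algebra_simps)
      then show "(?\<Phi> has_vector_derivative ?c\<^sup>2 * G ((b, p), t)) (at t within {0..1})"
        by (simp add: has_real_derivative_iff_has_vector_derivative has_vector_derivative_at_within)
    qed simp
    then have "integral {0..1} (\<lambda>t. ?c\<^sup>2 * G ((b, p), t)) = ?\<Phi> 1 - ?\<Phi> 0"
      by (rule integral_unique)
    moreover have "Fp (b, pc b) = 0"
      using crit subsetD[OF D(4) bp] by simp
    ultimately show ?thesis by (simp add: K_def)
  qed
  show thesis
  proof (rule that[OF D(1,3) _ smK Kb0 taylor])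
    show "D \<subseteq> W \<inter> B \<times> UNIV" using D(4) r(2) by blast
  qed
qed

text \<open>The coordinate \<open>v\<close> is a product whose first factor vanishes at the base
  point, so its fibre derivative there is the value of the second factor, a positive square root.
  Hence the shear \<open>(b, p) \<mapsto> (b, v (b, p))\<close> is locally invertible.\<close>

lemma fold_coordinate:
  fixes F :: "'a::euclidean_space \<times> real \<Rightarrow> real"
  defines "Fp \<equiv> \<lambda>z. frechet_derivative F (at z) (0, 1)"
  defines "Fpp \<equiv> \<lambda>z. frechet_derivative Fp (at z) (0, 1)"
  assumes "open W" "smooth_on W F" "open B" "b0 \<in> B" "smooth_on B pc"
    and crit: "\<forall>b\<in>B. (b, pc b) \<in> W \<and> Fp (b, pc b) = 0"
    and N: "Fpp (b0, pc b0) \<noteq> 0"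
  obtains U V v \<psi> where "open U" "(b0, pc b0) \<in> U" "U \<subseteq> W \<inter> B \<times> UNIV" "open V"
    "smooth_on U v" "smooth_on V \<psi>" "v (b0, pc b0) = 0"
    "\<And>b p. (b, p) \<in> U \<Longrightarrow> F (b, p) = F (b, pc b) + sgn (Fpp (b0, pc b0)) * (v (b, p))\<^sup>2"
    "\<And>b p. (b, p) \<in> U \<Longrightarrow> (b, v (b, p)) \<in> V \<and> \<psi> (b, v (b, p)) = p"
    "\<And>b t. (b, t) \<in> V \<Longrightarrow> (b, \<psi> (b, t)) \<in> U \<and> v (b, \<psi> (b, t)) = t"
proof -
  let ?z0 = "(b0, pc b0)"
  obtain D K where D: "open D" "?z0 \<in> D" "D \<subseteq> W \<inter> B \<times> UNIV" and K: "smooth_on D K"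
    "K ?z0 = Fpp ?z0 / 2"
    "\<And>b p. (b, p) \<in> D \<Longrightarrow> F (b, p) = F (b, pc b) + (p - pc b)\<^sup>2 * K (b, p)"
    using critical_point_factorization[OF assms(3-7) crit[unfolded Fp_def], folded Fp_def]
    unfolding Fpp_def by blast
  define \<sigma> where "\<sigma> = sgn (Fpp ?z0)"
  have \<sigma>: "\<sigma> * \<sigma> = 1" using N by (simp add: \<sigma>_def sgn_real_def)
  \<comment> \<open>The radicand must be positive for the square root to be smooth; at the base
    point it is half the absolute value of the second fibre derivative.\<close>
  define U0 where "U0 = D \<inter> (\<lambda>z. \<sigma> * K z) -` {0<..}"
  have "open U0" unfolding U0_def
    by (intro continuous_open_preimage continuous_intros smooth_on_continuous K(1) D(1) open_greaterThan)
  have z0: "?z0 \<in> U0" using D(2) K(2) N by (auto simp: U0_def \<sigma>_def sgn_real_def)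
  have "U0 \<subseteq> D" by (auto simp: U0_def)
  define c where "c z = snd z - pc (fst z)" for z
  define a where "a z = sqrt (\<sigma> * K z)" for z
  have "smooth_on U0 (\<lambda>z. pc (fst z))"
    by (rule smooth_on_compose[OF \<open>open U0\<close> assms(5,7) smooth_on_bounded_linear[OF bounded_linear_fst \<open>open U0\<close>]])
      (use D(3) \<open>U0 \<subseteq> D\<close> in auto)
  then have smc: "smooth_on U0 c"
    unfolding c_def
    by (rule smooth_on_diff[OF \<open>open U0\<close> smooth_on_bounded_linear[OF bounded_linear_snd \<open>open U0\<close>]])
  have sma: "smooth_on U0 a"
    unfolding a_def
    by (intro smooth_on_sqrt smooth_on_mult smooth_on_const smooth_on_subset[OF K(1)] \<open>open U0\<close>)
      (auto simp: U0_def)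
  define v where "v z = c z * a z" for z
  have smv: "smooth_on U0 v" unfolding v_def by (intro smooth_on_mult smc sma \<open>open U0\<close>)
  have "a ?z0 > 0" using z0 by (simp add: a_def U0_def)
  have dpc: "(pc has_derivative frechet_derivative pc (at b0)) (at b0)"
    using smooth_on_has_derivative[OF assms(7,6)] .
  have "(fst has_derivative fst) (at ?z0)"
    by (intro bounded_linear_imp_has_derivative bounded_linear_fst)
  then have "((\<lambda>z. pc (fst z)) has_derivative (\<lambda>h. frechet_derivative pc (at b0) (fst h))) (at ?z0)"
    by (rule has_derivative_compose[where g = pc]) (simp add: dpc)
  then have "(c has_derivative (\<lambda>h. snd h - frechet_derivative pc (at b0) (fst h))) (at ?z0)"
    unfolding c_def
    by (rule has_derivative_diff[OF bounded_linear_imp_has_derivative[OF bounded_linear_snd]])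
  from has_derivative_mult[OF this smooth_on_has_derivative[OF sma z0]]
  have "(v has_derivative (\<lambda>h. c ?z0 * frechet_derivative a (at ?z0) h
      + (snd h - frechet_derivative pc (at b0) (fst h)) * a ?z0)) (at ?z0)"
    unfolding v_def .
  then have "frechet_derivative v (at ?z0) = (\<lambda>h. c ?z0 * frechet_derivative a (at ?z0) h
      + (snd h - frechet_derivative pc (at b0) (fst h)) * a ?z0)"
    by (rule frechet_derivative_at[symmetric])
  moreover have "c ?z0 = 0" by (simp add: c_def)
  moreover have "frechet_derivative pc (at b0) 0 = 0"
    using linear_0[OF has_derivative_linear[OF dpc]] .
  ultimately have "frechet_derivative v (at ?z0) (0, 1) = a ?z0" by simp
  then have "frechet_derivative v (at ?z0) (0, 1) \<noteq> 0" using \<open>a ?z0 > 0\<close> by simp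
  then obtain U V \<psi> where U: "open U" "?z0 \<in> U" "U \<subseteq> U0" and V: "open V" "smooth_on V \<psi>"
      "\<And>x y. (x, y) \<in> U \<Longrightarrow> (x, v (x, y)) \<in> V \<and> \<psi> (x, v (x, y)) = y"
      "\<And>x t. (x, t) \<in> V \<Longrightarrow> (x, \<psi> (x, t)) \<in> U \<and> v (x, \<psi> (x, t)) = t"
    using smooth_shear_inverse[OF \<open>open U0\<close> smv z0] by metis
  have morse: "F (b, p) = F (b, pc b) + \<sigma> * (v (b, p))\<^sup>2" if "(b, p) \<in> U" for b p
  proof -
    have "(a (b, p))\<^sup>2 = \<sigma> * K (b, p)"
      using that U(3) by (auto simp: a_def U0_def)
    then have "\<sigma> * (v (b, p))\<^sup>2 = \<sigma> * \<sigma> * ((p - pc b)\<^sup>2 * K (b, p))"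
      by (simp add: v_def c_def power_mult_distrib)
    moreover have "(b, p) \<in> D" using that U(3) \<open>U0 \<subseteq> D\<close> by blast
    ultimately show ?thesis using K(3)[of b p] \<sigma> by simp
  qed
  have "v ?z0 = 0" by (simp add: v_def c_def)
  show thesis
  proof (rule that[OF U(1,2) _ V(1) smooth_on_subset[OF smv U(3)] V(2) \<open>v ?z0 = 0\<close> morse[unfolded \<sigma>_def] V(3,4)])
    show "U \<subseteq> W \<inter> B \<times> UNIV" using U(3) \<open>U0 \<subseteq> D\<close> D(3) by blast
  qed
qed

section \<open>The section surface\<close>

text \<open>A point of \<open>C\<close> is written \<open>(b, p)\<close> with \<open>b = (q\<^sub>2, p\<^sub>2)\<close> and \<open>p = p\<^sub>1\<close>, so that the fibres of
  \<open>\<pi>\<close> are the lines \<open>b = const\<close>.\<close>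

definition incl_C :: "(real \<times> real) \<times> real \<Rightarrow> phase" where
  "incl_C z = (0, fst (fst z), snd z, snd (fst z))"

definition coords_C :: "phase \<Rightarrow> (real \<times> real) \<times> real" where
  "coords_C x = ((fst (snd x), snd (snd (snd x))), fst (snd (snd x)))"

lemma coords_incl [simp]: "coords_C (incl_C z) = z"
  by (simp add: coords_C_def incl_C_def)

lemma incl_coords: "x \<in> plane_C \<Longrightarrow> incl_C (coords_C x) = x"
  by (auto simp: coords_C_def incl_C_def plane_C_def)

lemma fst_coords: "fst (coords_C x) = proj x"
  by (cases x) (simp add: coords_C_def)

lemma snd_coords: "snd (coords_C x) = p1_coord x"
  by (cases x) (simp add: coords_C_def)

lemma coords_eq: "coords_C x = (proj x, p1_coord x)"
  by (simp add: prod_eq_iff fst_coords snd_coords)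

lemma proj_incl [simp]: "proj (incl_C z) = fst z"
  by (simp add: incl_C_def)

lemma incl_in_sec: "incl_C z \<in> sec H E \<longleftrightarrow> H (incl_C z) = E"
  by (auto simp: sec_def plane_C_def incl_C_def)

lemma sec_incl_coords: "x \<in> sec H E \<Longrightarrow> incl_C (coords_C x) = x"
  by (simp add: sec_def incl_coords)

lemma sec_level: "x \<in> sec H E \<Longrightarrow> H x = E"
  by (simp add: sec_def)

lemma bounded_linear_incl_C: "bounded_linear incl_C"
  unfolding linear_conv_bounded_linear[symmetric] by (rule linearI) (simp_all add: incl_C_def)

lemma bounded_linear_coords_C: "bounded_linear coords_C"
  unfolding linear_conv_bounded_linear[symmetric] by (rule linearI) (simp_all add: coords_C_def)

text \<open>Agreement of \<open>g\<close> with \<open>F\<close> is asked only on \<open>W\<close>,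
  so the lemma can be iterated: applied to \<open>H\<close> it gives \<open>d_p1 H\<close> on
  \<open>W\<close>, and this identity feeds the second application, to \<open>d_p1 H\<close>
  itself.\<close>

lemma d_p1_incl_C:
  assumes "open W" "z \<in> W" "F differentiable at z"
    and eq: "\<And>z. z \<in> W \<Longrightarrow> g (incl_C z) = F z"
  shows "d_p1 g (incl_C z) = frechet_derivative F (at z) (0, 1)"
proof -
  obtain b p where z: "z = (b, p)" by (cases z)
  let ?D = "frechet_derivative F (at z)"
  have F: "(F has_derivative ?D) (at (b, p))"
    using assms(3) unfolding frechet_derivative_works z .
  have "((\<lambda>t. (b, t)) has_derivative (\<lambda>h. (0, h))) (at p)"
    by (auto intro!: derivative_eq_intros)
  from has_derivative_compose[OF this F]
  have "((\<lambda>t. F (b, t)) has_derivative (\<lambda>h. ?D (0, h))) (at p)" .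
  moreover have "?D (0, h) = ?D (0, 1) * h" for h
    using linear_scale[OF has_derivative_linear[OF F], of h "(0, 1)"] by simp
  then have "(\<lambda>h. ?D (0, h)) = (*) (?D (0, 1))" by (rule ext)
  ultimately have "((\<lambda>t. F (b, t)) has_real_derivative ?D (0, 1)) (at p)"
    by (simp only: has_field_derivative_def)
  moreover have "open (Pair b -` W)"
    using assms(1) by (intro open_vimage continuous_intros)
  ultimately have "((\<lambda>t. g (incl_C (b, t))) has_real_derivative ?D (0, 1)) (at p)"
    by (rule has_field_derivative_transform_within_open) (use assms(2) eq z in auto)
  then have "deriv (\<lambda>t. g (incl_C (b, t))) p = ?D (0, 1)"
    by (rule DERIV_imp_deriv)
  then show ?thesis by (simp add: z incl_C_def)
qed

section \<open>The critical branch and the level set in fold form\<close>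

lemma is_crit_branch_iff:
  "is_crit_branch H x0 pc \<longleftrightarrow> (\<exists>B. open B \<and> proj x0 \<in> B \<and> continuous_on B pc \<and>
     pc (proj x0) = p1_coord x0 \<and> (\<forall>b\<in>B. d_p1 H (incl_C (b, pc b)) = 0))"
  unfolding is_crit_branch_def incl_C_def by (simp add: case_prod_unfold)

lemma crit_value_eq: "crit_value H x0 b = H (incl_C (b, crit_branch H x0 b))"
  by (cases b) (simp add: incl_C_def)

text \<open>The Morse form is stated for the very branch selected by \<open>crit_branch\<close>, so
  its constant term is \<open>crit_value\<close>, whose smoothness near \<open>proj x0\<close> is
  obtained on the way.\<close>

lemma sec_normal_form:
  fixes H :: "phase \<Rightarrow> real"
  assumes "x0 \<in> Crit H E" and N: "open N" "x0 \<in> N" "smooth_on N H" and nondeg: "d_p1 (d_p1 H) x0 \<noteq> 0"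
  obtains B U V v \<psi> where "open B" "proj x0 \<in> B" "smooth_on B (crit_value H x0)"
    "crit_value H x0 (proj x0) = E"
    "open U" "coords_C x0 \<in> U" "U \<subseteq> B \<times> UNIV" "open V" "smooth_on U v" "smooth_on V \<psi>"
    "v (coords_C x0) = 0"
    "\<And>b p. (b, p) \<in> U \<Longrightarrow>
       H (incl_C (b, p)) = crit_value H x0 b + sgn (d_p1 (d_p1 H) x0) * (v (b, p))\<^sup>2"
    "\<And>b p. (b, p) \<in> U \<Longrightarrow> (b, v (b, p)) \<in> V \<and> \<psi> (b, v (b, p)) = p"
    "\<And>b t. (b, t) \<in> V \<Longrightarrow> (b, \<psi> (b, t)) \<in> U \<and> v (b, \<psi> (b, t)) = t"
proof -
  have sec: "x0 \<in> sec H E" and crit: "d_p1 H x0 = 0" using assms(1) by (auto simp: Crit_def)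
  let ?b0 = "proj x0" and ?p0 = "p1_coord x0"
  have x0: "incl_C (?b0, ?p0) = x0"
    using sec_incl_coords[OF sec] by (simp add: coords_eq)
  define W where "W = incl_C -` N"
  define F where "F z = H (incl_C z)" for z
  define Fp where "Fp z = frechet_derivative F (at z) (0, 1)" for z
  define Fpp where "Fpp z = frechet_derivative Fp (at z) (0, 1)" for z
  have W: "open W" unfolding W_def
    using N(1) by (intro open_vimage linear_continuous_on bounded_linear_incl_C)
  have z0: "(?b0, ?p0) \<in> W" by (simp add: W_def x0 N(2))
  have smF: "smooth_on W F" unfolding F_def
    by (rule smooth_on_compose[OF W N(1,3) smooth_on_bounded_linear[OF bounded_linear_incl_C W]])
      (auto simp: W_def)
  have smFp: "smooth_on W Fp" unfolding Fp_def by (rule smooth_on_frechet_derivative[OF smF])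
  have diff: "f differentiable at z" if "smooth_on W f" "z \<in> W" for f :: "(real \<times> real) \<times> real \<Rightarrow> real" and z
    using smooth_on_has_derivative[OF that] by (rule differentiableI)
  have d1: "d_p1 H (incl_C z) = Fp z" if "z \<in> W" for z
    unfolding Fp_def by (rule d_p1_incl_C[OF W that diff[OF smF that]]) (simp add: F_def)
  have d2: "d_p1 (d_p1 H) (incl_C z) = Fpp z" if "z \<in> W" for z
    unfolding Fpp_def by (rule d_p1_incl_C[OF W that diff[OF smFp that] d1])
  have Fp0: "Fp (?b0, ?p0) = 0" using d1[OF z0] crit by (simp add: x0)
  have Fpp0: "Fpp (?b0, ?p0) = d_p1 (d_p1 H) x0" using d2[OF z0] by (simp add: x0)
  have nd: "frechet_derivative Fp (at (?b0, ?p0)) (0, 1) \<noteq> 0"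
    using nondeg Fpp0 by (simp add: Fpp_def)
  let ?pc = "crit_branch H x0"
  have "\<exists>pc. is_crit_branch H x0 pc"
  proof (rule smooth_branch_exists[OF W smFp z0 Fp0 nd])
    fix B pc
    assume B: "open B" "?b0 \<in> B" "smooth_on B pc" "pc ?b0 = ?p0"
      and zero: "\<And>b. b \<in> B \<Longrightarrow> (b, pc b) \<in> W \<and> Fp (b, pc b) = 0"
    have "d_p1 H (incl_C (b, pc b)) = 0" if "b \<in> B" for b
      using zero[OF that] d1 by simp
    then show ?thesis
      unfolding is_crit_branch_iff using B smooth_on_continuous by blast
  qed
  then have "is_crit_branch H x0 ?pc"
    unfolding crit_branch_def by (rule someI_ex)
  then obtain B0 where B0: "open B0" "?b0 \<in> B0" "continuous_on B0 ?pc"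
    and pc0: "?pc ?b0 = ?p0" and pc: "\<And>b. b \<in> B0 \<Longrightarrow> d_p1 H (incl_C (b, ?pc b)) = 0"
    unfolding is_crit_branch_iff by blast
  \<comment> \<open>Away from the base point the chosen branch may leave \<open>W\<close>, where
    \<open>Fp\<close> is not known to agree with \<open>d_p1 H\<close>; hence the
    implication.\<close>
  have zero: "\<forall>b\<in>B0. (b, ?pc b) \<in> W \<longrightarrow> Fp (b, ?pc b) = 0"
    using pc d1 by metis
  obtain B where B: "open B" "?b0 \<in> B" "B \<subseteq> B0" and smpc: "smooth_on B ?pc"
    and inW: "\<And>b. b \<in> B \<Longrightarrow> (b, ?pc b) \<in> W"
    using continuous_branch_smooth[OF W smFp z0[folded pc0] nd[folded pc0] B0 zero] by blast
  have crit_B: "\<forall>b\<in>B. (b, ?pc b) \<in> W \<and> Fp (b, ?pc b) = 0"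
    using inW zero B(3) by blast
  have cv: "crit_value H x0 b = F (b, ?pc b)" for b
    unfolding F_def by (rule crit_value_eq)
  have "smooth_on B (\<lambda>b. (b, ?pc b))"
    by (intro smooth_on_Pair smpc B(1) smooth_on_bounded_linear bounded_linear_ident)
  then have "smooth_on B (\<lambda>b. F (b, ?pc b))"
    by (rule smooth_on_compose[OF B(1) W smF]) (use inW in auto)
  then have smcv: "smooth_on B (crit_value H x0)"
    by (rule smooth_on_cong[OF B(1)]) (simp add: cv)
  have "crit_value H x0 ?b0 = E"
    using sec_level[OF sec] by (simp add: cv pc0 F_def x0)
  have nd': "frechet_derivative (\<lambda>z. frechet_derivative F (at z) (0, 1)) (at (?b0, ?pc ?b0)) (0, 1) \<noteq> 0"
    using nd unfolding pc0 Fp_def .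
  have Fpp0': "frechet_derivative (\<lambda>z. frechet_derivative F (at z) (0, 1)) (at (?b0, ?pc ?b0)) (0, 1)
      = d_p1 (d_p1 H) x0"
    using Fpp0 unfolding pc0 Fpp_def Fp_def .
  show thesis
  proof (rule fold_coordinate[OF W smF B(1,2) smpc crit_B[unfolded Fp_def] nd'], unfold Fpp0')
    fix U V v \<psi>
    assume U: "open U" "(?b0, ?pc ?b0) \<in> U" "U \<subseteq> W \<inter> B \<times> UNIV" and V: "open V"
      and sm: "smooth_on U v" "smooth_on V \<psi>" and v0: "v (?b0, ?pc ?b0) = 0"
      and morse: "\<And>b p. (b, p) \<in> U \<Longrightarrow>
        F (b, p) = F (b, ?pc b) + sgn (d_p1 (d_p1 H) x0) * (v (b, p))\<^sup>2"
      and inv: "\<And>b p. (b, p) \<in> U \<Longrightarrow> (b, v (b, p)) \<in> V \<and> \<psi> (b, v (b, p)) = p"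
        "\<And>b t. (b, t) \<in> V \<Longrightarrow> (b, \<psi> (b, t)) \<in> U \<and> v (b, \<psi> (b, t)) = t"
    have c0: "coords_C x0 = (?b0, ?pc ?b0)" by (simp add: coords_eq pc0)
    show thesis
    proof (rule that[OF B(1,2) smcv \<open>crit_value H x0 ?b0 = E\<close> U(1) _ _ V sm _ _ inv])
      show "coords_C x0 \<in> U" "v (coords_C x0) = 0" using U(2) v0 by (simp_all only: c0)
      show "U \<subseteq> B \<times> UNIV" using U(3) by blast
      show "H (incl_C (b, p)) = crit_value H x0 b + sgn (d_p1 (d_p1 H) x0) * (v (b, p))\<^sup>2"
        if "(b, p) \<in> U" for b p
        using morse[OF that] unfolding cv by (simp only: F_def)
    qed
  qed
qed

text \<open>The plane chart is built from \<open>e\<close>, which equals the square of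
  \<open>v\<close> on the level set. The relation \<open>s (\<phi> x) = \<theta> (proj x)\<close>
  then both expresses the fold and lets the surface chart be inverted.\<close>

lemma sec_whitney_fold:
  fixes H :: "phase \<Rightarrow> real"
  assumes "x0 \<in> Crit H E" and N: "open N" "x0 \<in> N" "smooth_on N H" and nondeg: "d_p1 (d_p1 H) x0 \<noteq> 0"
    and transv: "frechet_derivative (crit_value H x0) (at (proj x0)) \<noteq> (\<lambda>_. 0)"
  shows "whitney_fold_at (sec H E) proj x0"
proof -
  define \<sigma> where "\<sigma> = sgn (d_p1 (d_p1 H) x0)"
  have \<sigma>: "\<sigma> * \<sigma> = 1" using nondeg by (simp add: \<sigma>_def sgn_real_def)
  let ?b0 = "proj x0"
  obtain B U V v \<psi> where B: "open B" "?b0 \<in> B" and smcv: "smooth_on B (crit_value H x0)"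
    and cv0: "crit_value H x0 ?b0 = E"
    and U: "open U" "coords_C x0 \<in> U" "U \<subseteq> B \<times> UNIV" and V: "open V"
    and smv: "smooth_on U v" and sm\<psi>: "smooth_on V \<psi>" and v0: "v (coords_C x0) = 0"
    and morse: "\<And>b p. (b, p) \<in> U \<Longrightarrow> H (incl_C (b, p)) = crit_value H x0 b + \<sigma> * (v (b, p))\<^sup>2"
    and fw: "\<And>b p. (b, p) \<in> U \<Longrightarrow> (b, v (b, p)) \<in> V \<and> \<psi> (b, v (b, p)) = p"
    and bw: "\<And>b t. (b, t) \<in> V \<Longrightarrow> (b, \<psi> (b, t)) \<in> U \<and> v (b, \<psi> (b, t)) = t"
    using sec_normal_form[OF assms(1-5)] unfolding \<sigma>_def by blast
  define e where "e b = \<sigma> * (E - crit_value H x0 b)" for b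
  have sme: "smooth_on B e"
    unfolding e_def by (intro smooth_on_mult smooth_on_diff smooth_on_const B(1) smcv)
  have level: "H (incl_C (b, p)) = E \<longleftrightarrow> (v (b, p))\<^sup>2 = e b" if "(b, p) \<in> U" for b p
  proof -
    have "\<sigma> = 1 \<or> \<sigma> = - 1" using nondeg by (simp add: \<sigma>_def sgn_real_def)
    then show ?thesis using morse[OF that] by (auto simp: e_def)
  qed
  have "(e has_derivative (\<lambda>h. \<sigma> * (0 - frechet_derivative (crit_value H x0) (at ?b0) h))) (at ?b0)"
    unfolding e_def
    by (rule has_derivative_mult_right[OF has_derivative_diff[OF has_derivative_const
          smooth_on_has_derivative[OF smcv B(2)]]])
  then have De: "frechet_derivative e (at ?b0) = (\<lambda>h. \<sigma> * (0 - frechet_derivative (crit_value H x0) (at ?b0) h))"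
    by (rule frechet_derivative_at[symmetric])
  have De0: "frechet_derivative e (at ?b0) \<noteq> (\<lambda>_. 0)"
  proof
    assume "frechet_derivative e (at ?b0) = (\<lambda>_. 0)"
    then have eq: "\<sigma> * (0 - frechet_derivative (crit_value H x0) (at ?b0) h) = 0" for h
      unfolding De by (rule fun_cong)
    have "\<sigma> \<noteq> 0" using \<sigma> by auto
    then have "frechet_derivative (crit_value H x0) (at ?b0) h = 0" for h
      using eq[of h] by simp
    then have "frechet_derivative (crit_value H x0) (at ?b0) = (\<lambda>_. 0)" by (rule ext)
    with transv show False by contradiction
  qed
  obtain V2 T2 and \<theta> \<tau> :: "real \<times> real \<Rightarrow> real \<times> real" where V2: "open V2" "?b0 \<in> V2" "V2 \<subseteq> B" and T2: "open T2"
    and sm\<theta>: "smooth_on V2 \<theta>" and sm\<tau>: "smooth_on T2 \<tau>" and \<theta>0: "\<theta> ?b0 = (0, e ?b0)"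
    and snd\<theta>: "\<And>b. snd (\<theta> b) = e b"
    and fw2: "\<And>b. b \<in> V2 \<Longrightarrow> \<theta> b \<in> T2 \<and> \<tau> (\<theta> b) = b"
    and bw2: "\<And>w. w \<in> T2 \<Longrightarrow> \<tau> w \<in> V2 \<and> \<theta> (\<tau> w) = w"
    using plane_coordinates_exist[OF B(1) sme B(2) De0] by blast
  have "e ?b0 = 0" by (simp add: e_def cv0)
  have chart2: "local_coordinates UNIV ?b0 V2 \<theta>"
    by (rule local_coordinatesI[OF V2(1) _ T2 sm\<theta> sm\<tau>])
      (use V2(2) \<theta>0 \<open>e ?b0 = 0\<close> fw2 bw2 in auto)
  define U' where "U' = coords_C -` (U \<inter> V2 \<times> UNIV)"
  have U': "open U'" unfolding U'_def
    using U(1) V2(1) by (intro open_vimage linear_continuous_on bounded_linear_coords_C open_Int open_Times open_UNIV)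
  have U'D: "(proj x, p1_coord x) \<in> U" "proj x \<in> V2" if "x \<in> U'" for x
    using that by (auto simp: U'_def coords_eq)
  define \<phi> where "\<phi> x = (fst (\<theta> (proj x)), v (coords_C x))" for x
  define s where "s w = (fst w, (snd w)\<^sup>2)" for w :: "real \<times> real"
  define T' where "T' = s -` T2"
  define g where "g w = (\<tau> (s w), snd w)" for w
  define T where "T = T' \<inter> g -` V"
  \<comment> \<open>The inverse chart: from \<open>w = (u, t)\<close> the base point is recovered as
    \<open>\<tau> (s w)\<close>, the point with plane coordinates \<open>u\<close> and
    \<open>t\<close> squared, and then \<open>p\<close> from the fibre coordinate \<open>t\<close>.
    The set \<open>T\<close> collects the \<open>w\<close> for which both steps are defined.\<close>
  define \<kappa> where "\<kappa> w = incl_C (\<tau> (s w), \<psi> (g w))" for w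
  have sms: "smooth_on S s" if "open S" for S
    unfolding s_def power2_eq_square
    by (intro smooth_on_Pair smooth_on_mult that smooth_on_bounded_linear bounded_linear_fst bounded_linear_snd)
  have T': "open T'" unfolding T'_def s_def
    using T2 by (intro open_vimage continuous_intros)
  have sm\<tau>s: "smooth_on T' (\<lambda>w. \<tau> (s w))"
    by (rule smooth_on_compose[OF T' T2 sm\<tau> sms[OF T']]) (auto simp: T'_def)
  have smg: "smooth_on T' g"
    unfolding g_def
    by (rule smooth_on_Pair[OF T' sm\<tau>s smooth_on_bounded_linear[OF bounded_linear_snd T']])
  have T: "open T" unfolding T_def
    by (rule continuous_open_preimage[OF smooth_on_continuous[OF smg] T' V])
  have "smooth_on T (\<lambda>w. \<psi> (g w))"
    by (rule smooth_on_compose[OF T V sm\<psi> smooth_on_subset[OF smg]]) (auto simp: T_def)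
  moreover have "smooth_on T (\<lambda>w. \<tau> (s w))"
    by (rule smooth_on_subset[OF sm\<tau>s]) (simp add: T_def)
  ultimately have sm\<kappa>: "smooth_on T \<kappa>"
    unfolding \<kappa>_def
    by (intro smooth_on_bounded_linear_compose[OF bounded_linear_incl_C T] smooth_on_Pair[OF T])
  have "smooth_on U' coords_C"
    by (rule smooth_on_bounded_linear[OF bounded_linear_coords_C U'])
  then have "smooth_on U' (\<lambda>x. v (coords_C x))"
    by (rule smooth_on_compose[OF U' U(1) smv]) (auto simp: U'_def)
  moreover have "smooth_on U' proj"
    unfolding fst_coords[symmetric]
    by (rule smooth_on_bounded_linear_compose[OF bounded_linear_fst U' \<open>smooth_on U' coords_C\<close>])
  then have "smooth_on U' (\<lambda>x. \<theta> (proj x))"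
    by (rule smooth_on_compose[OF U' V2(1) sm\<theta>]) (use U'D in auto)
  then have "smooth_on U' (\<lambda>x. fst (\<theta> (proj x)))"
    by (rule smooth_on_bounded_linear_compose[OF bounded_linear_fst U'])
  ultimately have sm\<phi>: "smooth_on U' \<phi>"
    unfolding \<phi>_def by (intro smooth_on_Pair[OF U'])
  have x0_sec: "x0 \<in> sec H E" using assms(1) by (simp add: Crit_def)
  have sq: "s (\<phi> x) = \<theta> (proj x)" if "x \<in> sec H E \<inter> U'" for x
  proof -
    have "incl_C (proj x, p1_coord x) = x"
      using sec_incl_coords[of x H E] that by (simp add: coords_eq)
    moreover have "H x = E" using that sec_level by blast
    ultimately have "(v (proj x, p1_coord x))\<^sup>2 = e (proj x)"
      using level[OF U'D(1)[of x]] that by simp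
    then show ?thesis
      by (simp add: s_def \<phi>_def coords_eq prod_eq_iff snd\<theta>)
  qed
  have chart1: "local_coordinates (sec H E) x0 U' \<phi>"
  proof (rule local_coordinatesI[OF U' _ T sm\<phi> sm\<kappa>])
    show "x0 \<in> sec H E \<inter> U'" using x0_sec U(2) V2(2) by (simp add: U'_def fst_coords mem_Times_iff)
    show "\<phi> x0 = (0, 0)" by (simp add: \<phi>_def \<theta>0 v0)
    show "\<phi> x \<in> T \<and> \<kappa> (\<phi> x) = x" if x: "x \<in> sec H E \<inter> U'" for x
    proof -
      have xU: "x \<in> U'" using x by simp
      have ts: "\<tau> (s (\<phi> x)) = proj x" "s (\<phi> x) \<in> T2" using sq[OF x] fw2[OF U'D(2)[OF xU]] by simp_all
      have g: "g (\<phi> x) = (proj x, v (proj x, p1_coord x))"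
        unfolding g_def ts(1) by (simp add: \<phi>_def coords_eq)
      have "\<kappa> (\<phi> x) = incl_C (coords_C x)"
        unfolding \<kappa>_def g ts(1) using fw[OF U'D(1)[OF xU]] by (simp add: coords_eq)
      also have "\<dots> = x" using sec_incl_coords[of x H E] x by simp
      finally show ?thesis
        using ts(2) fw[OF U'D(1)[OF xU]] by (simp add: T_def T'_def g)
    qed
    show "\<kappa> w \<in> sec H E \<inter> U' \<and> \<phi> (\<kappa> w) = w" if "w \<in> T" for w
    proof -
      let ?b = "\<tau> (s w)"
      have w: "s w \<in> T2" "(?b, snd w) \<in> V" using that by (simp_all add: T_def T'_def g_def)
      have b: "?b \<in> V2" "\<theta> ?b = s w" using bw2[OF w(1)] by simp_all
      have z: "(?b, \<psi> (g w)) \<in> U" "v (?b, \<psi> (g w)) = snd w" using bw[OF w(2)] by (simp_all add: g_def)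
      \<comment> \<open>This puts \<open>\<kappa> w\<close> on the level set: the second plane
        coordinate is \<open>e\<close>, and \<open>?b\<close> was chosen to make it a
        square.\<close>
      have "e ?b = (snd w)\<^sup>2" using snd\<theta>[of ?b] b(2) by (simp add: s_def)
      then have "H (\<kappa> w) = E" using level[OF z(1)] z(2) by (simp add: \<kappa>_def)
      then have "\<kappa> w \<in> sec H E" by (simp add: \<kappa>_def incl_in_sec)
      moreover have "\<kappa> w \<in> U'" using z(1) b(1) by (simp add: U'_def \<kappa>_def)
      moreover have "\<phi> (\<kappa> w) = w" using b(2) z(2) by (simp add: \<phi>_def \<kappa>_def s_def prod_eq_iff)
      ultimately show ?thesis by simp
    qed
  qed
  show ?thesis
    unfolding whitney_fold_at_def
  proof (intro exI conjI ballI allI impI)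
    show "local_coordinates (sec H E) x0 U' \<phi>" "local_coordinates UNIV ?b0 V2 \<theta>" by fact+
    show "proj ` (sec H E \<inter> U') \<subseteq> V2" using U'D(2) by blast
    show "\<theta> (proj y) = (a, t\<^sup>2)" if "y \<in> sec H E \<inter> U'" "\<phi> y = (a, t)" for y a t
      using sq[OF that(1)] that(2) by (simp add: s_def)
  qed
qed

section \<open>Number of preimages over a point of the base\<close>

lemma card_square_roots:
  fixes c :: real
  shows "c > 0 \<Longrightarrow> card {t. t\<^sup>2 = c} = 2" "card {t. t\<^sup>2 = (0::real)} = 1" "c < 0 \<Longrightarrow> {t. t\<^sup>2 = c} = {}"
proof -
  show "card {t. t\<^sup>2 = c} = 2" if "c > 0"
  proof -
    have "{t. t\<^sup>2 = c} = {sqrt c, - sqrt c}"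
      using that by (auto simp: real_sqrt_unique power2_eq_iff dest: sym)
    moreover have "sqrt c \<noteq> - sqrt c" using that by simp
    ultimately show ?thesis by simp
  qed
  have "{t. t\<^sup>2 = (0::real)} = {0}" by auto
  then show "card {t. t\<^sup>2 = (0::real)} = 1" by simp
  show "{t. t\<^sup>2 = c} = {}" if "c < 0"
    using that by (auto simp: not_less[symmetric])
qed

text \<open>The neighbourhoods must fit each other: \<open>U\<close> is cut out by a bound
  \<epsilon> on the fibre coordinate and \<open>V\<close> by the bound \<epsilon> squared on
  \<open>e\<close>. Then every square root of \<open>e b\<close> is the coordinate of a point of
  \<open>U\<close>.\<close>

lemma sec_fibre_count:
  fixes H :: "phase \<Rightarrow> real"
  assumes "x0 \<in> Crit H E" and N: "open N" "x0 \<in> N" "smooth_on N H" and nondeg: "d_p1 (d_p1 H) x0 \<noteq> 0"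
    and M: "open M" "x0 \<in> M"
  shows "\<exists>U V. open U \<and> x0 \<in> U \<and> U \<subseteq> M \<and> open V \<and> proj x0 \<in> V \<and>
        (\<forall>b\<in>V.
          (sgn (d_p1 (d_p1 H) x0) * (E - crit_value H x0 b) > 0
             \<longrightarrow> card {x \<in> sec H E \<inter> U. proj x = b} = 2) \<and>
          (crit_value H x0 b = E \<longrightarrow> card {x \<in> sec H E \<inter> U. proj x = b} = 1) \<and>
          (sgn (d_p1 (d_p1 H) x0) * (E - crit_value H x0 b) < 0
             \<longrightarrow> {x \<in> sec H E \<inter> U. proj x = b} = {}))"
proof -
  define \<sigma> where "\<sigma> = sgn (d_p1 (d_p1 H) x0)"
  have \<sigma>: "\<sigma> = 1 \<or> \<sigma> = - 1" using nondeg by (simp add: \<sigma>_def sgn_real_def)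
  let ?b0 = "proj x0"
  obtain B U0 V0 v \<psi> where B: "open B" "?b0 \<in> B" and smcv: "smooth_on B (crit_value H x0)"
    and cv0: "crit_value H x0 ?b0 = E"
    and U0: "open U0" "coords_C x0 \<in> U0" "U0 \<subseteq> B \<times> UNIV" and V0: "open V0"
    and smv: "smooth_on U0 v" and sm\<psi>: "smooth_on V0 \<psi>" and v0: "v (coords_C x0) = 0"
    and morse: "\<And>b p. (b, p) \<in> U0 \<Longrightarrow> H (incl_C (b, p)) = crit_value H x0 b + \<sigma> * (v (b, p))\<^sup>2"
    and fw: "\<And>b p. (b, p) \<in> U0 \<Longrightarrow> (b, v (b, p)) \<in> V0 \<and> \<psi> (b, v (b, p)) = p"
    and bw: "\<And>b t. (b, t) \<in> V0 \<Longrightarrow> (b, \<psi> (b, t)) \<in> U0 \<and> v (b, \<psi> (b, t)) = t"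
    using sec_normal_form[OF assms(1-5)] unfolding \<sigma>_def by blast
  define e where "e b = \<sigma> * (E - crit_value H x0 b)" for b
  have level: "H (incl_C (b, p)) = E \<longleftrightarrow> (v (b, p))\<^sup>2 = e b" if "(b, p) \<in> U0" for b p
    using \<sigma> morse[OF that] by (auto simp: e_def)
  have x0: "incl_C (coords_C x0) = x0"
    using assms(1) by (intro sec_incl_coords) (auto simp: Crit_def)
  \<comment> \<open>Pairs \<open>(b, t)\<close> whose point lies in the prescribed neighbourhood
    \<open>M\<close>; a product box inside this open set supplies \<open>A\<close> and
    \<epsilon>.\<close>
  define G where "G = V0 \<inter> (\<lambda>w. incl_C (fst w, \<psi> w)) -` M"
  have "continuous_on V0 (\<lambda>w. incl_C (fst w, \<psi> w))"
    by (intro bounded_linear.continuous_on[OF bounded_linear_incl_C] continuous_intros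
        smooth_on_continuous[OF sm\<psi>])
  then have "open G" unfolding G_def by (rule continuous_open_preimage[OF _ V0 M(1)])
  have "(?b0, 0) \<in> V0" "\<psi> (?b0, 0) = p1_coord x0"
    using fw[of ?b0 "p1_coord x0"] U0(2) v0 by (simp_all add: coords_eq)
  then have "(?b0, 0) \<in> G"
    using M(2) x0 by (simp add: G_def coords_eq)
  then obtain A I where A: "open A" "?b0 \<in> A" and I: "open I" "0 \<in> I" and AI: "A \<times> I \<subseteq> G"
    using open_prod_elim[OF \<open>open G\<close>] by (metis mem_Sigma_iff)
  obtain \<epsilon> where \<epsilon>: "\<epsilon> > 0" "ball 0 \<epsilon> \<subseteq> I"
    using I open_contains_ball by blast
  have in_G: "(b, t) \<in> G" if "b \<in> A" "\<bar>t\<bar> < \<epsilon>" for b t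
  proof -
    have "t \<in> I" using that(2) \<epsilon>(2) by (auto simp: dist_real_def)
    then show ?thesis using AI that(1) by blast
  qed
  let ?J = "A \<times> {- \<epsilon><..<\<epsilon>}"
  define Q where "Q = U0 \<inter> (\<lambda>z. (fst z, v z)) -` ?J"
  have "open Q" unfolding Q_def
    by (rule continuous_open_preimage)
      (intro continuous_intros smooth_on_continuous[OF smv] U0(1) open_Times A(1) open_greaterThanLessThan)+
  define U where "U = M \<inter> coords_C -` Q"
  define V where "V = (B \<inter> A) \<inter> crit_value H x0 -` {E - \<epsilon>\<^sup>2<..<E + \<epsilon>\<^sup>2}"
  have U: "open U" unfolding U_def
    using M(1) \<open>open Q\<close> by (intro open_Int open_vimage linear_continuous_on bounded_linear_coords_C)
  have V: "open V" unfolding V_def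
    by (rule continuous_open_preimage[OF continuous_on_subset[OF smooth_on_continuous[OF smcv]]])
      (use B A in auto)
  have U_x0: "x0 \<in> U"
    using M(2) U0(2) v0 A(2) \<epsilon>(1) by (simp add: U_def Q_def fst_coords)
  have V_b0: "?b0 \<in> V" using B(2) A(2) \<epsilon>(1) by (simp add: V_def cv0)
  \<comment> \<open>The fibre coordinate identifies the preimages of \<open>b\<close> in
    \<open>U\<close> with all real square roots of \<open>e b\<close>; the choice of
    \<open>V\<close> prevents any root from being lost.\<close>
  have fibre: "bij_betw (\<lambda>t. incl_C (b, \<psi> (b, t))) {t. t\<^sup>2 = e b} {x \<in> sec H E \<inter> U. proj x = b}"
    if b: "b \<in> V" for b
  proof -
    have bA: "b \<in> A" using b by (simp add: V_def)
    have "\<bar>E - crit_value H x0 b\<bar> < \<epsilon>\<^sup>2" using b by (auto simp: V_def)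
    then have "\<bar>e b\<bar> < \<epsilon>\<^sup>2" using \<sigma> by (auto simp: e_def)
    then have small: "\<bar>t\<bar> < \<epsilon>" if "t\<^sup>2 = e b" for t
      using that \<epsilon>(1) by (intro power2_less_imp_less[of "\<bar>t\<bar>" \<epsilon>]) simp_all
    show ?thesis
    proof (rule bij_betw_byWitness[where f' = "\<lambda>x. v (coords_C x)"])
      show "\<forall>t\<in>{t. t\<^sup>2 = e b}. v (coords_C (incl_C (b, \<psi> (b, t)))) = t"
        using bw in_G[OF bA small] by (simp add: G_def)
      show "(\<lambda>t. incl_C (b, \<psi> (b, t))) ` {t. t\<^sup>2 = e b} \<subseteq> {x \<in> sec H E \<inter> U. proj x = b}"
      proof (intro image_subsetI CollectI conjI IntI)
        fix t assume "t \<in> {t. t\<^sup>2 = e b}"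
        then have t: "t\<^sup>2 = e b" by simp
        have G: "(b, t) \<in> V0" "incl_C (b, \<psi> (b, t)) \<in> M"
          using in_G[OF bA small[OF t]] by (simp_all add: G_def)
        have z: "(b, \<psi> (b, t)) \<in> U0" "v (b, \<psi> (b, t)) = t" using bw[OF G(1)] by simp_all
        show "incl_C (b, \<psi> (b, t)) \<in> sec H E"
          using level[OF z(1)] z(2) t by (simp add: incl_in_sec)
        show "incl_C (b, \<psi> (b, t)) \<in> U"
          using G(2) z bA small[OF t] by (auto simp: U_def Q_def)
      qed simp
      have *: "(v (coords_C x))\<^sup>2 = e b \<and> incl_C (b, \<psi> (b, v (coords_C x))) = x"
        if x: "x \<in> {x \<in> sec H E \<inter> U. proj x = b}" for x
      proof -
        have c: "coords_C x = (b, p1_coord x)" using x by (simp add: coords_eq)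
        have ix: "incl_C (b, p1_coord x) = x" using sec_incl_coords[of x H E] x c by simp
        have z: "(b, p1_coord x) \<in> U0" using x c by (simp add: U_def Q_def)
        have "H x = E" using x sec_level by blast
        then have "(v (b, p1_coord x))\<^sup>2 = e b" using level[OF z] by (simp add: ix)
        moreover have "\<psi> (b, v (b, p1_coord x)) = p1_coord x" using fw[OF z] by simp
        ultimately show ?thesis by (simp add: c ix)
      qed
      show "\<forall>x\<in>{x \<in> sec H E \<inter> U. proj x = b}. incl_C (b, \<psi> (b, v (coords_C x))) = x"
        using * by blast
      show "(\<lambda>x. v (coords_C x)) ` {x \<in> sec H E \<inter> U. proj x = b} \<subseteq> {t. t\<^sup>2 = e b}"
        using * by blast
    qed
  qed
  have card: "card {x \<in> sec H E \<inter> U. proj x = b} = card {t. t\<^sup>2 = e b}" if "b \<in> V" for b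
    using bij_betw_same_card[OF fibre[OF that]] by (rule sym)
  show ?thesis
  proof (intro exI[of _ U] exI[of _ V] conjI ballI impI)
    show "U \<subseteq> M" by (simp add: U_def)
    fix b assume b: "b \<in> V"
    show "card {x \<in> sec H E \<inter> U. proj x = b} = 2" if "sgn (d_p1 (d_p1 H) x0) * (E - crit_value H x0 b) > 0"
      unfolding card[OF b] by (rule card_square_roots(1)) (use that in \<open>simp add: e_def \<sigma>_def\<close>)
    show "card {x \<in> sec H E \<inter> U. proj x = b} = 1" if "crit_value H x0 b = E"
    proof -
      have "e b = 0" using that by (simp add: e_def)
      show ?thesis unfolding card[OF b] \<open>e b = 0\<close> by (rule card_square_roots(2))
    qed
    show "{x \<in> sec H E \<inter> U. proj x = b} = {}" if "sgn (d_p1 (d_p1 H) x0) * (E - crit_value H x0 b) < 0"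
    proof -
      have "e b < 0" using that by (simp add: e_def \<sigma>_def)
      then have "{t. t\<^sup>2 = e b} = {}" by (rule card_square_roots(3))
      \<comment> \<open>Emptiness is taken from surjectivity, since \<open>card\<close> also
        vanishes on infinite sets.\<close>
      then show ?thesis using bij_betw_imp_surj_on[OF fibre[OF b]] by simp
    qed
  qed (fact U U_x0 V V_b0)+
qed

theorem theorem4p6:
  fixes H :: "real \<times> real \<times> real \<times> real \<Rightarrow> real" and E :: real
    and x0 :: "real \<times> real \<times> real \<times> real" and b0 :: "real \<times> real"
  assumes C2: "Ck_on 2 UNIV H"
    and crit: "x0 \<in> Crit H E"
    and b0: "b0 = proj x0"
    and smooth: "\<exists>N. open N \<and> x0 \<in> N \<and> smooth_on N H"
    and N: "d_p1 (d_p1 H) x0 \<noteq> 0"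
    and T: "frechet_derivative (crit_value H x0) (at b0) \<noteq> (\<lambda>_. 0)"
  shows "smooth_surface_near (sec H E) x0 \<and>
    whitney_fold_at (sec H E) proj x0 \<and>
    (\<forall>N. open N \<and> x0 \<in> N \<longrightarrow>
      (\<exists>U V. open U \<and> x0 \<in> U \<and> U \<subseteq> N \<and> open V \<and> b0 \<in> V \<and>
        (\<forall>b\<in>V.
          (sgn (d_p1 (d_p1 H) x0) * (E - crit_value H x0 b) > 0
             \<longrightarrow> card {x \<in> sec H E \<inter> U. proj x = b} = 2) \<and>
          (crit_value H x0 b = E \<longrightarrow> card {x \<in> sec H E \<inter> U. proj x = b} = 1) \<and>
          (sgn (d_p1 (d_p1 H) x0) * (E - crit_value H x0 b) < 0
             \<longrightarrow> {x \<in> sec H E \<inter> U. proj x = b} = {}))))"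
proof -
  obtain N0 where N0: "open N0" "x0 \<in> N0" "smooth_on N0 H" using smooth by blast
  have fold: "whitney_fold_at (sec H E) proj x0"
    using sec_whitney_fold[OF crit N0 N] T b0 by simp
  then have "smooth_surface_near (sec H E) x0"
    unfolding whitney_fold_at_def smooth_surface_near_def by blast
  with fold show ?thesis
    using sec_fibre_count[OF crit N0 N] unfolding b0 by blast
qed

end
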